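(* Let $F$ be a field and let $f \in F[x]$ be a monic polynomial of degree $n$ with $f' \neq 0$. Then the algorithm minDec described in the context, run on input $f$, correctly computes all minimal decompositions of $f$: it returns a list of decompositions $(g,h)$ of $f$ which contains every minimal decomposition of $f$, and which is empty if $f$ is indecomposable.
   Context: Decompositions. A pair $(g,h)$ of polynomials in $F[x]$, both of degree at least two, with $f = g\circ h$ is a decomposition of $f$; $f$ is decomposable if it has one and indecomposable otherwise. A polynomial is normal if it is monic and has zero constant term. A decomposition $(g,h)$ is minimal if $h$ is normal and indecomposable. Given $f$ and $h$, the component $g$ is unique. Blocks. For a permutation group $G$ on a finite set $Z$, a subset $B\subseteq Z$ is a block if for all $\sigma\in G$ the set $\sigma(B)\cap B$ is empty or equals $B$. The blocks $\emptyset$, $Z$ and singletons are trivial. A minimal block containing $\alpha$ is a nontrivial block containing $\alpha$ such that every block $B'\ni\alpha$ contained in it is trivial or equal to it. $G$ is primitive if all blocks are trivial. Subroutine Atkinson$(G,Z,\alpha)$: returns the list of all minimal blocks of the permutation group $G$ on $Z$ containing $\alpha$; if $G$ is primitive, the list consists of $Z$ only. Algorithm minDec (input: $f$). 1. Set List $=\{\}$ and let $F(\alpha)$ be the rational function field in $\alpha$. 2. Factor $f(x)-f(\alpha)$ in $F(\alpha)[x]$ into monic irreducible factors $\psi_1\cdots\psi_r$, ordered so that $\psi_i = x-\alpha_i$ with $\alpha_i\in F(\alpha)$ for $1\le i\le s$, $\alpha_1=\alpha$, and $\deg\psi_i\ge 2$ for $s<i\le r$. 3. If $s>1$: set $B_\alpha=\{\alpha_i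 : 1\le i\le s\}$ and $H=\{\ell_i : 1\le i\le s\}$, where $\alpha_i=\ell_i(\alpha)$ with $\ell_i\in F[x]$ linear ($H$ is a group under composition, acting on $B_\alpha$ via $\alpha\mapsto \ell_i(\alpha)$). For each $\Lambda$ in Atkinson$(H,B_\alpha,\alpha)$ with $|\Lambda|<n$: compute $h(x)=\prod_{\gamma\in\Lambda}(x-\gamma)-\prod_{\gamma\in\Lambda}(-\gamma)$, compute $g$ with $f=g\circ h$, and attach $(g,h)$ to List. 4. For each $\nu\in\{s+1,\dots,r\}$: let $\beta$ be a root of $\psi_\nu$ and let $\psi_i^*$ be $\psi_i$ with $\beta$ substituted for $\alpha$ ($1\le i\le r$). Compute the bipartite undirected graph $\Gamma_\beta$ with vertices $\psi_1,\dots,\psi_r$ on one side and $\psi_1^*,\dots,\psi_r^*$ on the other, with an edge between $\psi_i$ and $\psi_j^*$ if and only if $\gcd(\psi_i,\psi_j^* )\neq 1$. Compute $I_\nu=\{i : \psi_i \text{ is connected to } \psi_1 \text{ in } \Gamma_\beta\}$. If $I_\nu\neq\{1,\dots,r\}$: compute the normal $h\in F[x]$ with $h(x)-h(\alpha)=\prod_{i\in I_\nu}\psi_i$, compute $g$ with $f=g\circ h$, and attach $(g,h)$ to List. 5. Return List. *)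

theory Defs
  imports
    "HOL-Library.Monad_Syntax"
    "HOL-Computational_Algebra.Computational_Algebra"
    "HOL-Algebra.Bij"
    "HOL-Algebra.Algebraic_Closure_Type"
begin

section \<open>Decompositions\<close>

definition decomposition :: "'a::field poly \<Rightarrow> 'a poly \<Rightarrow> 'a poly \<Rightarrow> bool" where
  "decomposition f g h \<longleftrightarrow> 2 \<le> degree g \<and> 2 \<le> degree h \<and> f = pcompose g h"

definition decomposable :: "'a::field poly \<Rightarrow> bool" where
  "decomposable f \<longleftrightarrow> (\<exists>g h. decomposition f g h)"

abbreviation indecomposable :: "'a::field poly \<Rightarrow> bool" where
  "indecomposable f \<equiv> \<not> decomposable f"

definition normal_poly :: "'a::field poly \<Rightarrow> bool" where
  "normal_poly h \<longleftrightarrow> lead_coeff h = 1 \<and> coeff h 0 = 0"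

definition minimal_decomposition :: "'a::field poly \<Rightarrow> 'a poly \<Rightarrow> 'a poly \<Rightarrow> bool" where
  "minimal_decomposition f g h \<longleftrightarrow> decomposition f g h \<and> normal_poly h \<and> indecomposable h"


section \<open>Blocks and the Atkinson subroutine\<close>

definition permutation_group :: "('b \<Rightarrow> 'b) set \<Rightarrow> 'b set \<Rightarrow> bool" where
  "permutation_group G Z \<longleftrightarrow> finite Z \<and> subgroup G (BijGroup Z)"

definition block :: "('b \<Rightarrow> 'b) set \<Rightarrow> 'b set \<Rightarrow> 'b set \<Rightarrow> bool" where
  "block G Z B \<longleftrightarrow> B \<subseteq> Z \<and> (\<forall>\<sigma>\<in>G. \<sigma> ` B \<inter> B = {} \<or> \<sigma> ` B \<inter> B = B)"

definition trivial_block :: "'b set \<Rightarrow> 'b set \<Rightarrow> bool" where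
  "trivial_block Z B \<longleftrightarrow> B = {} \<or> B = Z \<or> is_singleton B"

definition minimal_block :: "('b \<Rightarrow> 'b) set \<Rightarrow> 'b set \<Rightarrow> 'b \<Rightarrow> 'b set \<Rightarrow> bool" where
  "minimal_block G Z a B \<longleftrightarrow> block G Z B \<and> \<not> trivial_block Z B \<and> a \<in> B \<and>
     (\<forall>B'. block G Z B' \<and> a \<in> B' \<and> B' \<subseteq> B \<longrightarrow> trivial_block Z B' \<or> B' = B)"

definition primitive_group :: "('b \<Rightarrow> 'b) set \<Rightarrow> 'b set \<Rightarrow> bool" where
  "primitive_group G Z \<longleftrightarrow> (\<forall>B. block G Z B \<longrightarrow> trivial_block Z B)"

text \<open>The order in which the blocks are listed is not specified, so this is the set of all
  admissible output lists.\<close>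

definition Atkinson :: "('b \<Rightarrow> 'b) set \<Rightarrow> 'b set \<Rightarrow> 'b \<Rightarrow> 'b set list set" where
  "Atkinson G Z a =
     {\<Lambda>s. set \<Lambda>s = (if primitive_group G Z then {Z} else {B. minimal_block G Z a B})}"


section \<open>The field of rational functions and the root substitution\<close>

text \<open>\<open>'a poly fract\<close> is the rational function field \<open>F(\<alpha>)\<close>, and \<open>gen\<close> is \<open>\<alpha>\<close>.\<close>

definition const :: "'a::field \<Rightarrow> 'a poly fract" where
  "const c = Fraction_Field.Fract [:c:] 1"

definition gen :: "'a::field poly fract" where
  "gen = Fraction_Field.Fract [:0, 1:] 1"

definition lift :: "'a::field poly \<Rightarrow> 'a poly fract poly" where
  "lift f = map_poly const f"

text \<open>\<open>difference_poly f\<close> is \<open>f(x) - f(\<alpha>)\<close> in \<open>F(\<alpha>)[x]\<close>.\<close>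

definition difference_poly :: "'a::field poly \<Rightarrow> 'a poly fract poly" where
  "difference_poly f = lift f - [:poly (lift f) gen:]"

text \<open>The value \<open>p(\<beta>) / q(\<beta>)\<close> of a rational function \<open>p(\<alpha>) / q(\<alpha>)\<close> at \<open>\<beta>\<close>.  It does not depend
  on the representation as long as \<open>q(\<beta>) \<noteq> 0\<close>, and such a representation always exists
  if \<open>\<beta>\<close> is transcendental over \<open>F\<close>.\<close>

definition subst_gen :: "'a::field poly fract alg_closure \<Rightarrow> 'a poly fract \<Rightarrow> 'a poly fract alg_closure" where
  "subst_gen \<beta> u = (THE v. \<exists>p q. u = Fraction_Field.Fract p q \<and>
     poly (map_poly (to_ac \<circ> const) q) \<beta> \<noteq> 0 \<and>
     v = poly (map_poly (to_ac \<circ> const) p) \<beta> / poly (map_poly (to_ac \<circ> const) q) \<beta>)"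


section \<open>The algorithm minDec\<close>

text \<open>
  The algorithm makes unspecified choices (the ordering of the factors, the order of the blocks
  returned by Atkinson, the roots \<open>\<beta>\<close>).  Moreover, a run may in principle get stuck, namely when it is
  told to compute an object that does not exist or is not unique, or when a subroutine is called on
  inadmissible arguments.  A stuck run has outcome \<^const>\<open>None\<close>, and \<open>minDec f\<close> is the set of
  the outcomes of all runs on input \<open>f\<close>.
\<close>

definition find_unique :: "('b \<Rightarrow> bool) \<Rightarrow> 'b option" where
  "find_unique P = (if \<exists>!x. P x then Some (THE x. P x) else None)"

definition compute_pair ::
    "'a::field poly \<Rightarrow> ('a poly \<Rightarrow> bool) \<Rightarrow> ('a poly \<times> 'a poly) option" where
  "compute_pair f P = do {
     h \<leftarrow> find_unique P;
     g \<leftarrow> find_unique (\<lambda>g. f = pcompose g h);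
     Some (g, h)
   }"

definition factorization ::
    "'a::field poly \<Rightarrow> nat \<Rightarrow> nat \<Rightarrow> (nat \<Rightarrow> 'a poly fract poly) \<Rightarrow> (nat \<Rightarrow> 'a poly fract) \<Rightarrow> bool" where
  "factorization f r s \<psi> \<alpha> \<longleftrightarrow>
     difference_poly f = (\<Prod>i=1..r. \<psi> i) \<and>
     (\<forall>i\<in>{1..r}. lead_coeff (\<psi> i) = 1 \<and> irreducible (\<psi> i)) \<and>
     1 \<le> s \<and> s \<le> r \<and> \<alpha> 1 = gen \<and>
     (\<forall>i\<in>{1..s}. \<psi> i = [:- \<alpha> i, 1:]) \<and>
     (\<forall>i\<in>{s<..r}. 2 \<le> degree (\<psi> i))"

definition linear_form :: "'a::field poly fract \<Rightarrow> 'a poly option" where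
  "linear_form \<gamma> = find_unique (\<lambda>l. degree l = 1 \<and> \<gamma> = poly (lift l) gen)"

text \<open>The permutation \<open>\<gamma> \<mapsto> l(\<gamma>)\<close> of \<open>B\<close>; by convention of \<^const>\<open>BijGroup\<close>, it is undefined
  outside \<open>B\<close>.\<close>

definition act_on :: "'a::field poly fract set \<Rightarrow> 'a poly \<Rightarrow> 'a poly fract \<Rightarrow> 'a poly fract" where
  "act_on B l = (\<lambda>\<gamma>\<in>B. poly (lift l) \<gamma>)"

definition block_pair :: "'a::field poly \<Rightarrow> 'a poly fract set \<Rightarrow> ('a poly \<times> 'a poly) option" where
  "block_pair f \<Lambda> =
     compute_pair f (\<lambda>h. lift h = (\<Prod>\<gamma>\<in>\<Lambda>. [:- \<gamma>, 1:]) - [:\<Prod>\<gamma>\<in>\<Lambda>. - \<gamma>:])"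

definition linear_step ::
    "'a::field poly \<Rightarrow> nat \<Rightarrow> (nat \<Rightarrow> 'a poly fract) \<Rightarrow> ('a poly \<times> 'a poly) list option set" where
  "linear_step f s \<alpha> =
     (if s > 1 then
        (case those (map (\<lambda>i. linear_form (\<alpha> i)) [1..<Suc s]) of
           None \<Rightarrow> {None}
         | Some ls \<Rightarrow>
             (let B = \<alpha> ` {1..s}; H = act_on B ` set ls in
              if permutation_group H B then
                {those (map (block_pair f) (filter (\<lambda>\<Lambda>. card \<Lambda> < degree f) \<Lambda>s)) | \<Lambda>s.
                   \<Lambda>s \<in> Atkinson H B gen}
              else {None}))
      else {Some []})"

text \<open>In the bipartite graph \<open>\<Gamma>\<^sub>\<beta>\<close>, the vertex \<open>\<psi>\<^sub>i\<close> is represented by \<open>Inl i\<close> and the vertex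
  \<open>\<psi>\<^sub>j\<^sup>*\<close> by \<open>Inr j\<close>.\<close>

definition graph_edges ::
    "nat \<Rightarrow> (nat \<Rightarrow> 'a::field poly fract poly) \<Rightarrow> 'a poly fract alg_closure \<Rightarrow> ((nat + nat) \<times> (nat + nat)) set" where
  "graph_edges r \<psi> \<beta> = {(Inl i, Inr j) | i j. i \<in> {1..r} \<and> j \<in> {1..r} \<and>
     gcd (map_poly to_ac (\<psi> i)) (map_poly (subst_gen \<beta>) (\<psi> j)) \<noteq> 1}"

definition component ::
    "nat \<Rightarrow> (nat \<Rightarrow> 'a::field poly fract poly) \<Rightarrow> 'a poly fract alg_closure \<Rightarrow> nat set" where
  "component r \<psi> \<beta> =
     {i \<in> {1..r}. (Inl i, Inl 1) \<in> (graph_edges r \<psi> \<beta> \<union> (graph_edges r \<psi> \<beta>)\<inverse>)\<^sup>*}"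

definition graph_step ::
    "'a::field poly \<Rightarrow> nat \<Rightarrow> (nat \<Rightarrow> 'a poly fract poly) \<Rightarrow> 'a poly fract alg_closure \<Rightarrow>
     ('a poly \<times> 'a poly) list option" where
  "graph_step f r \<psi> \<beta> =
     (let I = component r \<psi> \<beta> in
      if I \<noteq> {1..r} then
        do {
          gh \<leftarrow> compute_pair f (\<lambda>h. normal_poly h \<and> difference_poly h = (\<Prod>i\<in>I. \<psi> i));
          Some [gh]
        }
      else Some [])"

definition minDec :: "'a::field poly \<Rightarrow> ('a poly \<times> 'a poly) list option set" where
  "minDec f =
     {do {
        L \<leftarrow> out;
        Ls \<leftarrow> those (map (\<lambda>\<nu>. graph_step f r \<psi> (\<beta> \<nu>)) [Suc s..<Suc r]);
        Some (L @ concat Ls)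
      } | r s \<psi> \<alpha> \<beta> out.
        factorization f r s \<psi> \<alpha> \<and>
        out \<in> linear_step f s \<alpha> \<and>
        (\<forall>\<nu>\<in>{s<..r}. poly (map_poly to_ac (\<psi> \<nu>)) (\<beta> \<nu>) = 0)}"

end

theory Submission
  imports Defs
begin

text \<open>Write \<open>y\<close> for the generator of the rational function field \<open>K = F(y)\<close> and \<open>C\<close> for its algebraic
closure. Decompositions are read off from divisors of \<open>f(x) - f(y)\<close>: for a nonconstant \<open>h\<close>, a
polynomial \<open>g\<close> with \<open>f = g \<circ> h\<close> exists if and only if \<open>h(x) - h(y)\<close> divides \<open>f(x) - f(y)\<close> in
\<open>K[x]\<close>. Every step of the algorithm proposes a set of irreducible factors of \<open>f(x) - f(y)\<close>, and
the proof has to show that their product \<open>P\<close> has the form \<open>h(x) - h(y)\<close>, and that every minimal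
decomposition is proposed at some step. Blocks of a Galois group would explain both, but all that
is needed of them can be had by elementary means.

The form of \<open>P\<close>. A version of Gauss's lemma shows that the coefficients of a monic divisor \<open>P\<close> of
\<open>f(x) - f(y)\<close> lie in \<open>F[y]\<close>, and counting total degrees shows that the coefficient of \<open>x\<^sup>k\<close> has
degree at most \<open>deg P - k\<close> (\<open>monic_factor_of_difference_poly\<close>). Suppose moreover that \<open>y\<close> is a root
of \<open>P\<close> and that each coefficient \<open>p(y)\<close> of \<open>P\<close> is invariant, in the sense that \<open>P\<close> divides
\<open>p(x) - p(y)\<close>. For the coefficients of \<open>x\<^sup>k\<close> with \<open>k > 0\<close>, this polynomial has smaller degree
than \<open>P\<close> and thus vanishes. So only the constant coefficient involves \<open>y\<close>, and \<open>P = h(x) - h(y)\<close>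
(\<open>difference_poly_if_coeffs_invariant\<close>).

Linear factors. The roots of \<open>f(x) - f(y)\<close> in \<open>K\<close> are the \<open>l(y)\<close> where \<open>l\<close> is a linear polynomial
with \<open>f \<circ> l = f\<close>; these \<open>l\<close> form a group that acts regularly on the roots. A block containing \<open>y\<close>
corresponds to a subgroup, whose elements permute the factors of \<open>P\<close> when substituted for \<open>y\<close>; so
the coefficients are invariant.

Nonlinear factors. Let \<open>\<beta> \<in> C\<close> be a root of \<open>f(x) - f(y)\<close>. It is transcendental over \<open>F\<close>, so
that \<open>y \<mapsto> \<beta>\<close> embeds \<open>K\<close> into \<open>C\<close>, and \<open>f(x) - f(y) = f(x) - f(\<beta>)\<close> has two factorizations, one
over \<open>F(y)\<close> and one over \<open>F(\<beta>)\<close>. A connected component of the graph \<open>\<Gamma>\<^sub>\<beta>\<close> collects a set of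
roots that is a union of root sets of factors on both sides. Hence \<open>P\<close> has its coefficients in
both fields. If a polynomial with coefficients in both fields vanishes at \<open>y\<close>, then it vanishes
along the whole component, because an irreducible factor that shares a root with it divides it.
This applies to \<open>p(x) - p(y)\<close> for each coefficient \<open>p(y)\<close> of \<open>P\<close>, which gives the invariance.

Completeness. Let \<open>(g, h)\<close> be a minimal decomposition. If \<open>h(x) - h(y)\<close> has a nonlinear factor
\<open>\<psi>\<^sub>\<nu>\<close>, then \<open>h(\<beta>) = h(y)\<close> for the root \<open>\<beta>\<close> of \<open>\<psi>\<^sub>\<nu>\<close>; so \<open>h(x) - h(y)\<close> has its coefficients in both
fields and is divisible by the polynomial that step \<open>\<nu>\<close> finds. If it has only linear factors, then
its roots form a block, and a smaller block would give a divisor of \<open>h(x) - h(y)\<close>. In both cases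
the indecomposability of \<open>h\<close> forces the polynomial found to be \<open>h\<close>.\<close>

section \<open>Ring homomorphisms applied to coefficients\<close>

text \<open>The substitutions in this development (of constants, of \<open>l(y)\<close> or of a root \<open>\<beta>\<close> for \<open>y\<close>) all act
on the coefficients of polynomials in \<open>x\<close>; this locale treats them uniformly.\<close>

locale unital_hom =
  fixes \<sigma> :: "'r::comm_ring_1 \<Rightarrow> 's::comm_ring_1"
  assumes hom_add: "\<sigma> (x + y) = \<sigma> x + \<sigma> y"
    and hom_mult: "\<sigma> (x * y) = \<sigma> x * \<sigma> y"
    and hom_one: "\<sigma> 1 = 1"
begin

lemma hom_zero: "\<sigma> 0 = 0"
  using hom_add[of 0 0] by simp

lemma hom_uminus: "\<sigma> (- x) = - \<sigma> x"
  using hom_add[of x "- x"] by (simp add: hom_zero eq_neg_iff_add_eq_0 add.commute)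

lemma hom_diff: "\<sigma> (x - y) = \<sigma> x - \<sigma> y"
  using hom_add[of x "- y"] by (simp add: hom_uminus)

lemma hom_sum: "\<sigma> (sum g A) = (\<Sum>x\<in>A. \<sigma> (g x))"
  by (induction A rule: infinite_finite_induct) (simp_all add: hom_zero hom_add)

lemma coeff_map [simp]: "coeff (map_poly \<sigma> p) n = \<sigma> (coeff p n)"
  by (simp add: coeff_map_poly hom_zero)

lemma map_0 [simp]: "map_poly \<sigma> 0 = 0"
  by (intro poly_eqI) (simp add: hom_zero)

lemma map_pCons [simp]: "map_poly \<sigma> (pCons a p) = pCons (\<sigma> a) (map_poly \<sigma> p)"
  by (intro poly_eqI) (simp add: coeff_pCons split: nat.splits)

lemma map_1 [simp]: "map_poly \<sigma> 1 = 1"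
  by (simp add: one_pCons hom_one)

lemma map_add [simp]: "map_poly \<sigma> (p + q) = map_poly \<sigma> p + map_poly \<sigma> q"
  by (intro poly_eqI) (simp add: hom_add)

lemma map_diff [simp]: "map_poly \<sigma> (p - q) = map_poly \<sigma> p - map_poly \<sigma> q"
  by (intro poly_eqI) (simp add: hom_diff)

lemma map_mult [simp]: "map_poly \<sigma> (p * q) = map_poly \<sigma> p * map_poly \<sigma> q"
  by (intro poly_eqI) (simp add: coeff_mult hom_sum hom_mult)

lemma map_prod: "map_poly \<sigma> (prod P A) = (\<Prod>i\<in>A. map_poly \<sigma> (P i))"
  by (induction A rule: infinite_finite_induct) simp_all

lemma map_dvd: "p dvd q \<Longrightarrow> map_poly \<sigma> p dvd map_poly \<sigma> q"
  by (auto elim!: dvdE)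

lemma poly_map: "poly (map_poly \<sigma> p) (\<sigma> x) = \<sigma> (poly p x)"
  by (induction p) (simp_all add: hom_zero hom_add hom_mult)

lemma map_pcompose: "map_poly \<sigma> (pcompose p q) = pcompose (map_poly \<sigma> p) (map_poly \<sigma> q)"
  by (induction p) (simp_all add: pcompose_pCons)

lemma degree_map_monic:
  assumes "lead_coeff p = 1"
  shows "degree (map_poly \<sigma> p) = degree p"
proof (rule antisym)
  show "degree (map_poly \<sigma> p) \<le> degree p"
    by (rule degree_le) (simp add: coeff_eq_0 hom_zero)
  show "degree p \<le> degree (map_poly \<sigma> p)"
    by (rule le_degree) (simp add: assms hom_one)
qed

lemma monic_map: "lead_coeff p = 1 \<Longrightarrow> lead_coeff (map_poly \<sigma> p) = 1"
  by (simp add: degree_map_monic hom_one)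

end

lemma map_poly_pderiv:
  fixes \<sigma> :: "'r::idom \<Rightarrow> 's::idom"
  assumes "unital_hom \<sigma>"
  shows "map_poly \<sigma> (pderiv p) = pderiv (map_poly \<sigma> p)"
proof -
  interpret unital_hom \<sigma> by fact
  have "\<sigma> (of_nat n) = of_nat n" for n
    by (induction n) (simp_all add: hom_zero hom_add hom_one)
  then show ?thesis
    by (intro poly_eqI) (simp add: coeff_pderiv hom_mult hom_add hom_one)
qed

lemma unital_hom_comp:
  assumes "unital_hom \<sigma>" "unital_hom \<tau>"
  shows "unital_hom (\<tau> \<circ> \<sigma>)"
proof -
  interpret s: unital_hom \<sigma> by fact
  interpret t: unital_hom \<tau> by fact
  show ?thesis
    by standard (simp_all add: s.hom_add t.hom_add s.hom_mult t.hom_mult s.hom_one t.hom_one)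
qed

lemma unital_hom_map_poly:
  assumes "unital_hom \<sigma>"
  shows "unital_hom (map_poly \<sigma>)"
proof -
  interpret unital_hom \<sigma> by fact
  show ?thesis by standard simp_all
qed

lemma unital_hom_poly: "unital_hom (\<lambda>p. poly p x)"
  by standard simp_all

lemma unital_hom_const_poly: "unital_hom (\<lambda>c::'a::comm_ring_1. [:c:])"
  by standard (simp_all add: one_pCons)

lemma unital_hom_pcompose: "unital_hom (\<lambda>p::'a::comm_ring_1 poly. pcompose p l)"
  by standard (simp_all add: pcompose_add pcompose_mult pcompose_1)

lemma unital_hom_to_fract: "unital_hom (to_fract :: 'a::idom \<Rightarrow> 'a fract)"
  by standard simp_all

lemma unital_hom_to_ac: "unital_hom (to_ac :: 'a::field \<Rightarrow> 'a alg_closure)"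
  by standard simp_all

lemma unital_hom_id: "unital_hom (\<lambda>x::'a::comm_ring_1. x)"
  by standard simp_all

lemma field_hom_eq_0_iff:
  fixes \<sigma> :: "'k::field \<Rightarrow> 'l::field"
  assumes "unital_hom \<sigma>"
  shows "\<sigma> x = 0 \<longleftrightarrow> x = 0"
proof -
  interpret unital_hom \<sigma> by fact
  have "\<sigma> x * \<sigma> (inverse x) = 1" if "x \<noteq> 0"
    using that by (simp flip: hom_mult add: hom_one)
  then have "\<sigma> x \<noteq> 0" if "x \<noteq> 0"
    using that by fastforce
  then show ?thesis
    by (auto simp: hom_zero)
qed

section \<open>Divisibility of polynomials and roots in an extension field\<close>

lemma field_poly_bezout:
  fixes p q :: "'k::field poly"
  shows "\<exists>d a b. d dvd p \<and> d dvd q \<and> d = a * p + b * q"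
proof (induction "if q = 0 then 0 else Suc (degree q)" arbitrary: p q rule: less_induct)
  case less
  show ?case
  proof (cases "q = 0")
    case True
    have "p dvd p \<and> p dvd q \<and> p = 1 * p + 0 * q"
      using True by simp
    then show ?thesis by blast
  next
    case False
    have "(if p mod q = 0 then 0 else Suc (degree (p mod q))) < (if q = 0 then 0 else Suc (degree q))"
      using False degree_mod_less[of q p] by auto
    from less[OF this] obtain d a b where d: "d dvd q" "d dvd p mod q" "d = a * q + b * (p mod q)"
      by blast
    have "d dvd p"
      using d(1,2) by (simp add: dvd_mod_iff)
    moreover have "d = b * p + (a - b * (p div q)) * q"
    proof -
      have "d = a * q + b * (p - p div q * q)"
        using d(3) by (simp add: minus_div_mult_eq_mod)
      then show ?thesis by (simp add: algebra_simps)
    qed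
    ultimately show ?thesis using d(1) by blast
  qed
qed

text \<open>Otherwise \<open>p\<close> and \<open>q\<close> would be coprime over the small field, and the Bezout identity, mapped to the
large field and evaluated at \<open>x\<close>, would read \<open>0 = 1\<close>.\<close>

lemma irreducible_dvd_if_common_root:
  fixes \<sigma> :: "'k::field \<Rightarrow> 'l::field"
  assumes "unital_hom \<sigma>" "irreducible p"
    and "poly (map_poly \<sigma> p) x = 0" "poly (map_poly \<sigma> q) x = 0"
  shows "p dvd q"
proof -
  interpret unital_hom \<sigma> by fact
  obtain d a b where d: "d dvd p" "d dvd q" "d = a * p + b * q"
    using field_poly_bezout by blast
  have "poly (map_poly \<sigma> d) x = 0"
    using assms(3,4) by (simp add: d(3))
  then have "\<not> map_poly \<sigma> d dvd 1"
    by (metis dvdE mult_zero_left poly_1 poly_mult zero_neq_one)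
  then have "\<not> is_unit d"
    using map_dvd[of d 1] by auto
  with assms(2) d(1) have "p dvd d"
    using irreducibleD' by blast
  then show ?thesis using d(2) dvd_trans by blast
qed

text \<open>The right notion of squarefreeness in any characteristic: \<open>p\<close> and its derivative have no
common root.\<close>

definition simple_roots :: "'k::field poly \<Rightarrow> bool" where
  "simple_roots p \<longleftrightarrow> (\<forall>x. poly p x = 0 \<longrightarrow> poly (pderiv p) x \<noteq> 0)"

text \<open>Let \<open>p = d e\<close> where \<open>d\<close> is a greatest common divisor of \<open>p\<close> and \<open>q\<close>. A root of \<open>e\<close> is a root of \<open>p\<close>,
hence of \<open>q\<close> and of \<open>d\<close>, so it would be a multiple root of \<open>p\<close>. The conclusion holds over the small
field although roots are compared in the large one.\<close>

lemma simple_roots_dvd_if_roots_subset: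
  fixes \<sigma> :: "'k::field \<Rightarrow> 'l::alg_closed_field"
  assumes "unital_hom \<sigma>" "simple_roots (map_poly \<sigma> p)"
    and roots: "\<And>x. poly (map_poly \<sigma> p) x = 0 \<Longrightarrow> poly (map_poly \<sigma> q) x = 0"
  shows "p dvd q"
proof -
  interpret unital_hom \<sigma> by fact
  have inj: "\<sigma> x = 0 \<longleftrightarrow> x = 0" for x
    using field_hom_eq_0_iff[OF assms(1)] .
  have deg: "degree (map_poly \<sigma> u) = degree u" for u
    by (rule degree_map_poly) (simp add: inj)
  obtain d a b where d: "d dvd p" "d dvd q" "d = a * p + b * q"
    using field_poly_bezout by blast
  obtain e where e: "p = d * e" using d(1) by blast
  have "degree e = 0"
  proof (rule ccontr)
    assume "degree e \<noteq> 0"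
    then obtain x where x: "poly (map_poly \<sigma> e) x = 0"
      using alg_closed_imp_poly_has_root[of "map_poly \<sigma> e"] by (auto simp: deg)
    then have px: "poly (map_poly \<sigma> p) x = 0" by (simp add: e)
    with roots have "poly (map_poly \<sigma> d) x = 0" by (simp add: d(3))
    then have "poly (pderiv (map_poly \<sigma> p)) x = 0"
      using x by (simp add: e pderiv_mult)
    then show False
      using px assms(2) unfolding simple_roots_def by blast
  qed
  moreover have "e \<noteq> 0"
    using assms(2) by (auto simp: e simple_roots_def)
  ultimately have "is_unit e"
    by (metis is_unit_iff_degree)
  then have "p dvd d" by (auto simp: e)
  then show ?thesis using d(2) dvd_trans by blast
qed

lemma simple_roots_dvd:
  fixes p q :: "'k::field poly"
  assumes "simple_roots q" "p dvd q"
  shows "simple_roots p"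
proof -
  obtain e where q: "q = p * e" using assms(2) by blast
  show ?thesis
    using assms(1) unfolding simple_roots_def q by (auto simp: pderiv_mult)
qed

lemma monic_dvd_antisym:
  fixes p q :: "'k::field poly"
  assumes "p dvd q" "q dvd p" "lead_coeff p = 1" "lead_coeff q = 1"
  shows "p = q"
proof -
  obtain c where c: "p = q * c" using assms(2) by blast
  have "p \<noteq> 0" "q \<noteq> 0" using assms(3,4) by auto
  have "degree p \<le> degree q" using assms(1) \<open>q \<noteq> 0\<close> by (rule dvd_imp_degree_le)
  then have "degree c = 0" using c \<open>p \<noteq> 0\<close> \<open>q \<noteq> 0\<close> by (auto simp: degree_mult_eq)
  moreover have "lead_coeff c = 1" using assms(3,4) by (simp add: c lead_coeff_mult)
  ultimately show ?thesis using c by (metis degree_eq_zeroE lead_coeff_pCons(2) mult.right_neutral one_pCons)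
qed

lemma monic_dvd_degree_eq:
  fixes p q :: "'k::field poly"
  assumes "p dvd q" "degree q \<le> degree p" "lead_coeff p = 1" "lead_coeff q = 1"
  shows "p = q"
proof -
  obtain c where c: "q = p * c" using assms(1) by blast
  have "c \<noteq> 0" "p \<noteq> 0" using assms(3,4) c by auto
  then have "degree c = 0" using c assms(2) by (auto simp: degree_mult_eq)
  with \<open>c \<noteq> 0\<close> have "is_unit c" by (metis is_unit_iff_degree)
  then have "q dvd p" by (auto simp: c)
  then show ?thesis using assms monic_dvd_antisym by blast
qed

lemma prod_linear_dvd:
  fixes q :: "'k::field poly"
  assumes "finite S" "\<And>x. x \<in> S \<Longrightarrow> poly q x = 0"
  shows "(\<Prod>x\<in>S. [:- x, 1:]) dvd q"
  using assms
proof (induction S arbitrary: q rule: finite_induct)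
  case (insert a S)
  obtain u where u: "q = [:- a, 1:] * u"
    using insert.prems[of a] by (auto simp: poly_eq_0_iff_dvd)
  have "poly u x = 0" if "x \<in> S" for x
    using insert.prems[of x] insert.hyps(2) that by (auto simp: u)
  then have "(\<Prod>x\<in>S. [:- x, 1:]) dvd u" by (rule insert.IH)
  then show ?case
    using insert.hyps u by (auto simp del: mult_pCons_left intro: mult_dvd_mono)
qed simp

lemma poly_prod_linear_eq_0_iff:
  fixes x :: "'k::field"
  shows "finite S \<Longrightarrow> poly (\<Prod>y\<in>S. [:- y, 1:]) x = 0 \<longleftrightarrow> x \<in> S"
  by (auto simp: poly_prod)

lemma monic_prod_linear: "lead_coeff (\<Prod>y\<in>S. [:- y, 1 :: 'k::field:]) = 1"
  by (induction S rule: infinite_finite_induct) (simp_all add: lead_coeff_mult del: mult_pCons_left)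

lemma degree_prod_linear: "degree (\<Prod>y\<in>S. [:- y, 1 :: 'k::field:]) = card S"
  by (subst degree_prod_eq_sum_degree) auto

section \<open>Monic factors over a rational function field\<close>

lemma exists_prime_factor_field_poly:
  fixes p :: "'a::field poly"
  assumes "degree p > 0"
  shows "\<exists>q. prime_elem q \<and> q dvd p"
  using assms
proof (induction "degree p" arbitrary: p rule: less_induct)
  case less
  show ?case
  proof (cases "irreducible p")
    case True
    then show ?thesis
      by (intro exI[of _ p] conjI field_poly_irreducible_imp_prime dvd_refl)
  next
    case False
    have "p \<noteq> 0" using less.prems by auto
    then have "\<not> is_unit p" using less.prems by (simp add: is_unit_iff_degree)
    with \<open>p \<noteq> 0\<close> False obtain a b where ab: "p = a * b" "\<not> is_unit a" "\<not> is_unit b"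
      unfolding irreducible_def by blast
    have nz: "a \<noteq> 0" "b \<noteq> 0" using ab(1) less.prems by auto
    then have "degree a > 0" "degree b > 0"
      using ab(2,3) by (simp_all add: is_unit_iff_degree)
    moreover have "degree p = degree a + degree b"
      using nz by (simp add: ab(1) degree_mult_eq)
    ultimately obtain q where "prime_elem q" "q dvd a"
      using less.hyps[of a] by auto
    then show ?thesis using ab(1) dvd_mult2 by blast
  qed
qed

lemma smult_left_cancel:
  fixes P Q :: "'a::idom poly"
  shows "smult c P = smult c Q \<Longrightarrow> c \<noteq> 0 \<Longrightarrow> P = Q"
  by (metis right_minus_eq smult_diff_right smult_eq_0_iff)

text \<open>Gauss's lemma for factors that become monic over the field of fractions. Removing one prime
factor of \<open>d e\<close> at a time, primality in \<open>F[y][x]\<close> tells which of the two factors \<open>P\<close> and \<open>Q\<close> it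
divides.\<close>

lemma gauss_leading_coeffs_split_off:
  fixes P Q N :: "'a::field poly poly"
  assumes "P * Q = smult (d * e) N" "lead_coeff P = d" "lead_coeff Q = e" "d \<noteq> 0" "e \<noteq> 0"
  shows "(\<exists>P'. P = smult d P') \<and> (\<exists>Q'. Q = smult e Q')"
  using assms
proof (induction "degree d + degree e" arbitrary: P Q d e rule: less_induct)
  case less
  show ?case
  proof (cases "degree d + degree e = 0")
    case True
    then obtain c c' where c: "d = [:c:]" "e = [:c':]"
      by (auto elim!: degree_eq_zeroE)
    then have "c \<noteq> 0" "c' \<noteq> 0" using less.prems by auto
    then have "P = smult d (smult [:inverse c:] P)" "Q = smult e (smult [:inverse c':] Q)"
      by (simp_all add: c flip: one_pCons)
    then show ?thesis by (intro conjI exI)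
  next
    case False
    then have "degree (d * e) > 0"
      using less.prems by (simp add: degree_mult_eq)
    then obtain q where q: "prime_elem q" "q dvd d * e"
      using exists_prime_factor_field_poly by blast
    have "[:q:] dvd P * Q"
      using q(2) less.prems(1) by (simp add: const_poly_dvd_iff)
    moreover have "prime_elem [:q:]"
      using q(1) by (simp add: prime_elem_const_poly_iff)
    ultimately consider "[:q:] dvd P" | "[:q:] dvd Q"
      using prime_elem_dvd_multD by blast
    moreover have "degree q > 0"
      using q(1) by (auto simp: prime_elem_def is_unit_iff_degree)
    moreover have "q \<noteq> 0" using q(1) by auto
    ultimately show ?thesis
    proof cases
      case 1
      then obtain P1 where P1: "P = smult q P1" by (elim dvdE) simp
      define d1 where "d1 = lead_coeff P1"
      have d: "d = q * d1" using less.prems(2) unfolding P1 d1_def by (simp only: lead_coeff_smult)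
      then have "d1 \<noteq> 0" using less.prems by auto
      have "smult q (P1 * Q) = smult q (smult (d1 * e) N)"
        using less.prems(1) by (simp add: P1 d ac_simps)
      then have "P1 * Q = smult (d1 * e) N"
        using \<open>q \<noteq> 0\<close> by (rule smult_left_cancel)
      moreover have "degree d1 + degree e < degree d + degree e"
        using \<open>q \<noteq> 0\<close> \<open>d1 \<noteq> 0\<close> \<open>degree q > 0\<close> by (simp add: d degree_mult_eq)
      ultimately have "(\<exists>P'. P1 = smult d1 P') \<and> (\<exists>Q'. Q = smult e Q')"
        using less.hyps[OF _ _ d1_def[symmetric] less.prems(3) \<open>d1 \<noteq> 0\<close> less.prems(5)] by blast
      then obtain P2 Q2 where "P1 = smult d1 P2" "Q = smult e Q2" by blast
      then have "P = smult d P2" "Q = smult e Q2" by (simp_all add: P1 d)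
      then show ?thesis by blast
    next
      case 2
      then obtain Q1 where Q1: "Q = smult q Q1" by (elim dvdE) simp
      define e1 where "e1 = lead_coeff Q1"
      have e: "e = q * e1" using less.prems(3) unfolding Q1 e1_def by (simp only: lead_coeff_smult)
      then have "e1 \<noteq> 0" using less.prems by auto
      have "smult q (P * Q1) = smult q (smult (d * e1) N)"
        using less.prems(1) by (simp add: Q1 e ac_simps)
      then have "P * Q1 = smult (d * e1) N"
        using \<open>q \<noteq> 0\<close> by (rule smult_left_cancel)
      moreover have "degree d + degree e1 < degree d + degree e"
        using \<open>q \<noteq> 0\<close> \<open>e1 \<noteq> 0\<close> \<open>degree q > 0\<close> by (simp add: e degree_mult_eq)
      ultimately have "(\<exists>P'. P = smult d P') \<and> (\<exists>Q'. Q1 = smult e1 Q')"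
        using less.hyps[OF _ _ less.prems(2) e1_def[symmetric] less.prems(4) \<open>e1 \<noteq> 0\<close>] by blast
      then obtain P2 Q2 where "P = smult d P2" "Q1 = smult e1 Q2" by blast
      then have "P = smult d P2" "Q = smult e Q2" by (simp_all add: Q1 e)
      then show ?thesis by blast
    qed
  qed
qed

lemma clear_denominators:
  fixes P :: "'a::idom fract poly"
  shows "\<exists>d P'. d \<noteq> 0 \<and> smult (to_fract d) P = map_poly to_fract P'"
proof (induction P)
  case 0
  have "(1::'a) \<noteq> 0 \<and> smult (to_fract 1) 0 = map_poly to_fract (0 :: 'a poly)" by simp
  then show ?case by blast
next
  case (pCons c P)
  interpret unital_hom "to_fract :: 'a \<Rightarrow> _" by (rule unital_hom_to_fract)
  obtain d P' where d: "d \<noteq> 0" "smult (to_fract d) P = map_poly to_fract P'"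
    using pCons.IH by blast
  obtain a b where c: "c = Fract a b" "b \<noteq> 0" by (cases c) auto
  have "to_fract b * c = to_fract a"
    using c(2) by (simp add: c(1) Fract_conv_to_fract)
  then have "to_fract (d * b) * c = to_fract (d * a)"
    by (simp add: mult.assoc)
  moreover have "smult (to_fract (d * b)) P = map_poly to_fract (smult b P')"
    by (simp add: d(2)[symmetric] mult.commute)
  ultimately have "smult (to_fract (d * b)) (pCons c P) = map_poly to_fract (pCons (d * a) (smult b P'))"
    by (simp del: to_fract_mult fract_poly_smult)
  moreover have "d * b \<noteq> 0" using d(1) c(2) by simp
  ultimately show ?case by blast
qed

text \<open>Clearing denominators turns \<open>P\<close> and \<open>Q\<close> into polynomials whose leading coefficients are the chosen
denominators; by Gauss's lemma these divide out again.\<close>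

lemma monic_factors_integral:
  fixes P Q :: "'a::field poly fract poly"
  assumes "P * Q = map_poly to_fract N" "lead_coeff P = 1" "lead_coeff Q = 1"
  obtains P' Q' where "P = map_poly to_fract P'" "Q = map_poly to_fract Q'" "P' * Q' = N"
proof -
  interpret unital_hom "to_fract :: 'a poly \<Rightarrow> _" by (rule unital_hom_to_fract)
  obtain d P1 where d: "d \<noteq> 0" "smult (to_fract d) P = map_poly to_fract P1"
    using clear_denominators by blast
  obtain e Q1 where e: "e \<noteq> 0" "smult (to_fract e) Q = map_poly to_fract Q1"
    using clear_denominators by blast
  have deg: "degree (map_poly to_fract R) = degree R" for R :: "'a poly poly"
    by (rule degree_map_poly) simp
  have "lead_coeff (smult (to_fract d) P) = to_fract d" using assms(2) by simp
  then have ld: "lead_coeff P1 = d" by (simp add: d(2) deg)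
  have "lead_coeff (smult (to_fract e) Q) = to_fract e" using assms(3) by simp
  then have le: "lead_coeff Q1 = e" by (simp add: e(2) deg)
  have "map_poly to_fract (P1 * Q1) = smult (to_fract d) P * smult (to_fract e) Q"
    by (simp add: d(2) e(2))
  also have "\<dots> = map_poly to_fract (smult (d * e) N)"
    using assms(1) by (simp add: mult.commute)
  finally have "P1 * Q1 = smult (d * e) N"
    by (simp only: fract_poly_eq_iff)
  from gauss_leading_coeffs_split_off[OF this ld le d(1) e(1)]
  obtain P' Q' where PQ: "P1 = smult d P'" "Q1 = smult e Q'" by blast
  have P: "P = map_poly to_fract P'"
    by (rule smult_left_cancel[of "to_fract d"]) (simp_all add: PQ(1) d)
  have Q: "Q = map_poly to_fract Q'"
    by (rule smult_left_cancel[of "to_fract e"]) (simp_all add: PQ(2) e)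
  have "map_poly to_fract (P' * Q') = map_poly to_fract N"
    using assms(1) by (simp add: P Q)
  then show ?thesis using that P Q by (simp only: fract_poly_eq_iff)
qed

section \<open>Weighted degrees of bivariate polynomials\<close>

text \<open>The homomorphism \<open>F[y][x] \<rightarrow> F[x][T]\<close> with \<open>y \<mapsto> T\<close> and \<open>x \<mapsto> x T\<^sup>w\<close>. The degree in \<open>T\<close> of the
image is the weighted degree in which \<open>y\<close> has weight \<open>1\<close> and \<open>x\<close> has weight \<open>w\<close>: the degree in \<open>y\<close>
for \<open>w = 0\<close>, and the total degree for \<open>w = 1\<close>. That it is additive on products is then the
corresponding fact for univariate polynomials.\<close>

definition weight_poly :: "nat \<Rightarrow> 'a::field poly poly \<Rightarrow> 'a poly poly" where
  "weight_poly w p = poly (map_poly (map_poly (\<lambda>c. [:c:])) p) (monom (monom 1 1) w)"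

lemma unital_hom_weight_poly: "unital_hom (weight_poly w)"
proof -
  have "unital_hom ((\<lambda>p. poly p (monom (monom 1 1) w)) \<circ> map_poly (map_poly (\<lambda>c::'a. [:c:])))"
    by (intro unital_hom_comp unital_hom_map_poly unital_hom_const_poly unital_hom_poly)
  then show ?thesis by (simp add: weight_poly_def[abs_def] o_def)
qed

lemma coeff_weight_poly:
  "coeff (coeff (weight_poly w p) k) j = (if w * j \<le> k then coeff (coeff p j) (k - w * j) else 0)"
proof -
  interpret c: unital_hom "\<lambda>c::'a. [:c:]" by (rule unital_hom_const_poly)
  interpret m: unital_hom "map_poly (\<lambda>c::'a. [:c:])"
    by (rule unital_hom_map_poly[OF unital_hom_const_poly])
  show ?thesis
  proof (induction p arbitrary: k j)
    case 0
    show ?case by (simp add: weight_poly_def)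
  next
    case (pCons a p)
    have eq: "weight_poly w (pCons a p) = map_poly (\<lambda>c. [:c:]) a + monom (monom 1 1) w * weight_poly w p"
      by (simp add: weight_poly_def)
    show ?case
      by (cases j) (auto simp: eq coeff_monom_mult pCons.IH coeff_pCons split: nat.splits)
  qed
qed

lemma degree_weight_poly_le_iff:
  "degree (weight_poly w p) \<le> D \<longleftrightarrow> (\<forall>i j. coeff (coeff p j) i \<noteq> 0 \<longrightarrow> i + w * j \<le> D)"
proof
  assume D: "degree (weight_poly w p) \<le> D"
  show "\<forall>i j. coeff (coeff p j) i \<noteq> 0 \<longrightarrow> i + w * j \<le> D"
  proof (intro allI impI)
    fix i j assume "coeff (coeff p j) i \<noteq> 0"
    then have "coeff (coeff (weight_poly w p) (i + w * j)) j \<noteq> 0"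
      by (simp add: coeff_weight_poly)
    then have "coeff (weight_poly w p) (i + w * j) \<noteq> 0" by auto
    then show "i + w * j \<le> D" using D le_degree le_trans by blast
  qed
next
  assume D: "\<forall>i j. coeff (coeff p j) i \<noteq> 0 \<longrightarrow> i + w * j \<le> D"
  show "degree (weight_poly w p) \<le> D"
  proof (intro degree_le allI impI poly_eqI)
    fix k j assume "D < k"
    then show "coeff (coeff (weight_poly w p) k) j = coeff 0 j"
      using D[rule_format, of j "k - w * j"] by (cases "w * j \<le> k") (auto simp: coeff_weight_poly)
  qed
qed

lemma degree_weight_poly_mult:
  assumes "p \<noteq> 0" "q \<noteq> 0"
  shows "degree (weight_poly w (p * q)) = degree (weight_poly w p) + degree (weight_poly w q)"
proof -
  interpret unital_hom "weight_poly w :: 'a poly poly \<Rightarrow> _" by (rule unital_hom_weight_poly)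
  have "weight_poly w r \<noteq> 0" if "r \<noteq> 0" for r :: "'a poly poly"
  proof -
    obtain j i where ij: "coeff (coeff r j) i \<noteq> 0"
      using \<open>r \<noteq> 0\<close> by (metis leading_coeff_0_iff)
    then have "coeff (coeff (weight_poly w r) (i + w * j)) j \<noteq> 0"
      by (simp add: coeff_weight_poly)
    then show ?thesis by auto
  qed
  then show ?thesis using assms by (simp add: hom_mult degree_mult_eq)
qed

section \<open>The polynomial \<open>f(x) - f(y)\<close> and its monic factors\<close>

lemma const_eq_to_fract: "const c = to_fract [:c:]"
  by (simp add: const_def to_fract_def)

lemma gen_eq_to_fract: "gen = to_fract [:0, 1:]"
  by (simp add: gen_def to_fract_def)

lemma unital_hom_const: "unital_hom (const :: 'a::field \<Rightarrow> 'a poly fract)"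
  using unital_hom_comp[OF unital_hom_const_poly unital_hom_to_fract]
  by (simp add: o_def const_eq_to_fract[abs_def])

lemma const_eq_0_iff [simp]: "const c = 0 \<longleftrightarrow> c = 0"
  by (simp add: const_eq_to_fract)

lemma const_eq_iff [simp]: "const c = const c' \<longleftrightarrow> c = c'"
  by (simp add: const_eq_to_fract)

lemma unital_hom_lift: "unital_hom (lift :: 'a::field poly \<Rightarrow> _)"
  using unital_hom_map_poly[OF unital_hom_const] by (simp add: lift_def[abs_def])

lemma coeff_lift [simp]: "coeff (lift p) k = const (coeff p k)"
  by (simp add: lift_def coeff_map_poly)

lemma degree_lift [simp]: "degree (lift p) = degree p"
  unfolding lift_def by (rule degree_map_poly) simp

lemma lift_eq_iff [simp]: "lift p = lift q \<longleftrightarrow> p = q"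
  by (simp add: poly_eq_iff)

lemma lift_pCons: "lift (pCons c p) = pCons (const c) (lift p)"
  by (intro poly_eqI) (simp add: coeff_pCons split: nat.splits)

lemma lift_const: "lift [:c:] = [:const c:]"
  by (intro poly_eqI) (simp add: coeff_pCons split: nat.splits)

lemma poly_lift_to_fract: "poly (lift p) (to_fract l) = to_fract (pcompose p l)"
proof (induction p)
  case 0
  show ?case by (simp add: lift_def)
next
  case (pCons c p)
  then show ?case by (simp add: lift_pCons pcompose_pCons const_eq_to_fract)
qed

lemma poly_lift_gen: "poly (lift p) gen = to_fract p"
  by (simp add: gen_eq_to_fract poly_lift_to_fract pcompose_idR)

lemma difference_poly_eq: "difference_poly f = lift f - [:to_fract f:]"
  by (simp add: difference_poly_def poly_lift_gen)

lemma coeff_difference_poly: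
  "coeff (difference_poly f) k = const (coeff f k) - (if k = 0 then to_fract f else 0)"
  by (simp add: difference_poly_eq coeff_pCons split: nat.splits)

lemma poly_difference_poly_to_fract:
  "poly (difference_poly f) (to_fract l) = to_fract (pcompose f l) - to_fract f"
  by (simp add: difference_poly_eq poly_lift_to_fract)

lemma poly_difference_poly_gen: "poly (difference_poly f) gen = 0"
  by (simp add: difference_poly_def)

lemma degree_difference_poly [simp]: "degree (difference_poly f) = degree f"
proof (cases "degree f = 0")
  case True
  then obtain c where "f = [:c:]" by (auto elim: degree_eq_zeroE)
  then show ?thesis by (simp add: difference_poly_eq lift_const)
next
  case False
  then show ?thesis
    unfolding difference_poly_eq diff_conv_add_uminus
    by (subst degree_add_eq_left) simp_all
qed

lemma monic_difference_poly:
  assumes "lead_coeff f = 1" "degree f > 0"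
  shows "lead_coeff (difference_poly f) = 1"
  using assms by (simp add: coeff_difference_poly unital_hom.hom_one[OF unital_hom_const])

lemma difference_poly_eq_0_iff: "difference_poly f = 0 \<longleftrightarrow> degree f = 0"
proof
  assume "difference_poly f = 0"
  then show "degree f = 0" using degree_difference_poly[of f] by simp
next
  assume "degree f = 0"
  then obtain c where "f = [:c:]" by (auto elim: degree_eq_zeroE)
  then show "difference_poly f = 0" by (simp add: difference_poly_eq lift_const const_eq_to_fract)
qed

text \<open>\<open>f(x) - f(y)\<close> as an element of \<open>F[y][x]\<close>, where degrees in \<open>y\<close> make sense.\<close>

definition bivariate_difference :: "'a::field poly \<Rightarrow> 'a poly poly" where
  "bivariate_difference f = map_poly (\<lambda>c. [:c:]) f - [:f:]"

lemma coeff_bivariate_difference: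
  "coeff (bivariate_difference f) k = [:coeff f k:] - (if k = 0 then f else 0)"
  by (simp add: bivariate_difference_def coeff_map_poly coeff_pCons split: nat.splits)

lemma map_poly_bivariate_difference:
  "map_poly to_fract (bivariate_difference f) = difference_poly f"
  by (intro poly_eqI)
     (simp add: coeff_map_poly coeff_bivariate_difference coeff_difference_poly const_eq_to_fract)

lemma degree_weight_bivariate_difference:
  "degree (weight_poly 1 (bivariate_difference f)) \<le> degree f"
  unfolding degree_weight_poly_le_iff
proof (intro allI impI)
  fix i j
  assume *: "coeff (coeff (bivariate_difference f) j) i \<noteq> 0"
  show "i + 1 * j \<le> degree f"
  proof (cases "j = 0")
    case True
    with * have "i = 0 \<or> coeff f i \<noteq> 0"
      by (auto simp: coeff_bivariate_difference coeff_pCons split: nat.splits)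
    then show ?thesis using True le_degree by fastforce
  next
    case False
    with * have "i = 0" "coeff f j \<noteq> 0"
      by (auto simp: coeff_bivariate_difference coeff_pCons split: nat.splits)
    then show ?thesis using le_degree by fastforce
  qed
qed

lemma monic_cofactor:
  fixes P N :: "'k::field poly"
  assumes "P dvd N" "lead_coeff P = 1" "lead_coeff N = 1"
  obtains Q where "P * Q = N" "lead_coeff Q = 1"
proof -
  obtain Q where "N = P * Q" using assms(1) by blast
  then show ?thesis using that assms(2,3) by (auto simp: lead_coeff_mult)
qed

lemma monic_ne_0: "lead_coeff (p :: 'r::idom poly) = 1 \<Longrightarrow> p \<noteq> 0"
  by auto

lemma monic_map_poly_to_fract:
  assumes "lead_coeff (map_poly to_fract P) = 1"
  shows "lead_coeff P = 1"
proof -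
  have "degree (map_poly to_fract P) = degree P"
    by (rule degree_map_poly) simp
  then have "to_fract (lead_coeff P) = to_fract 1"
    using assms by (simp add: coeff_map_poly)
  then show ?thesis by (simp only: to_fract_eq_iff)
qed

text \<open>Both \<open>P\<close> and its cofactor have coefficients in \<open>F[y]\<close> by Gauss's lemma. Being monic in \<open>x\<close>, they
have total degrees at least their degrees in \<open>x\<close>; but these bounds already add up to the total
degree of \<open>f(x) - f(y)\<close>, so both are attained.\<close>

lemma monic_factor_of_difference_poly:
  fixes f :: "'a::field poly"
  assumes f: "lead_coeff f = 1" "degree f > 0"
    and P: "P dvd difference_poly f" "lead_coeff P = 1"
  obtains P' where "P = map_poly to_fract P'"
    "\<And>k. k \<le> degree P \<Longrightarrow> degree (coeff P' k) \<le> degree P - k"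
proof -
  obtain Q where Q: "P * Q = difference_poly f" "lead_coeff Q = 1"
    using monic_cofactor[OF P monic_difference_poly[OF f]] by blast
  have "P * Q = map_poly to_fract (bivariate_difference f)"
    by (simp add: Q map_poly_bivariate_difference)
  from monic_factors_integral[OF this P(2) Q(2)]
  obtain P' Q' where PQ: "P = map_poly to_fract P'" "Q = map_poly to_fract Q'"
      "P' * Q' = bivariate_difference f" by blast
  have deg: "degree P' = degree P" "degree Q' = degree Q"
    unfolding PQ by (simp_all add: degree_map_poly)
  have monic: "lead_coeff P' = 1" "lead_coeff Q' = 1"
    using P(2) Q(2) unfolding PQ by (simp_all only: monic_map_poly_to_fract)
  \<comment> \<open>The leading monomial in \<open>x\<close> has coefficient \<open>1\<close> and so contributes to the total degree.\<close>
  have lower: "degree R \<le> degree (weight_poly 1 R)" if "lead_coeff R = 1" for R :: "'a poly poly"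
  proof -
    have "coeff (coeff R (degree R)) 0 \<noteq> 0" using that by simp
    then have "0 + 1 * degree R \<le> degree (weight_poly 1 R)"
      using degree_weight_poly_le_iff[of 1 R "degree (weight_poly 1 R)"] by blast
    then show ?thesis by simp
  qed
  have "degree (weight_poly 1 P') + degree (weight_poly 1 Q') \<le> degree f"
    using degree_weight_bivariate_difference[of f] degree_weight_poly_mult[of P' Q' 1]
      monic_ne_0[OF monic(1)] monic_ne_0[OF monic(2)] by (simp add: PQ(3))
  moreover have "degree f = degree P + degree Q"
    using degree_mult_eq[OF monic_ne_0[OF P(2)] monic_ne_0[OF Q(2)]] by (simp add: Q(1))
  ultimately have "degree (weight_poly 1 P') \<le> degree P"
    using lower[OF monic(1)] lower[OF monic(2)] deg by linarith
  then have w: "i + 1 * k \<le> degree P" if "coeff (coeff P' k) i \<noteq> 0" for i k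
    using that unfolding degree_weight_poly_le_iff by blast
  have "degree (coeff P' k) \<le> degree P - k" if "k \<le> degree P" for k
    using w[of k "degree (coeff P' k)"] by (cases "coeff P' k = 0") auto
  then show ?thesis using that PQ(1) by blast
qed

section \<open>Roots of \<open>f(x) - f(y)\<close> and the substitution of a root for \<open>y\<close>\<close>

text \<open>Being a monic factor of a polynomial in which \<open>y\<close> does not occur, \<open>d\<close> lies in \<open>F[x]\<close> (degrees in
\<open>y\<close> add up). But modulo a nonconstant element of \<open>F[x]\<close>, the polynomial \<open>f(x)\<close> reduces to an
element of \<open>F[x]\<close>, which cannot be \<open>f(y)\<close>.\<close>

lemma constant_common_factor:
  fixes f q :: "'a::field poly"
  assumes f: "lead_coeff f = 1" "degree f > 0" and q: "q \<noteq> 0"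
    and d: "lead_coeff d = 1" "d dvd lift q" "d dvd difference_poly f"
  shows "degree d = 0"
proof (rule ccontr)
  assume pos: "degree d \<noteq> 0"
  define q' where "q' = smult (inverse (lead_coeff q)) q"
  have q': "lead_coeff q' = 1" using q by (simp add: q'_def)
  have "lift q' = smult (const (inverse (lead_coeff q))) (lift q)"
    by (intro poly_eqI) (simp add: q'_def unital_hom.hom_mult[OF unital_hom_const])
  then have dq: "d dvd lift q'" using d(2) by (simp add: dvd_smult)
  have lq: "lead_coeff (lift q') = 1"
    using q' by (simp add: unital_hom.hom_one[OF unital_hom_const])
  obtain e where e: "d * e = lift q'" "lead_coeff e = 1"
    using monic_cofactor[OF dq d(1) lq] by blast
  have "lift q' = map_poly to_fract (map_poly (\<lambda>c. [:c:]) q')"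
    by (intro poly_eqI) (simp add: coeff_map_poly const_eq_to_fract)
  with e have "d * e = map_poly to_fract (map_poly (\<lambda>c. [:c:]) q')" by simp
  from monic_factors_integral[OF this d(1) e(2)]
  obtain D E where DE: "d = map_poly to_fract D" "e = map_poly to_fract E"
      "D * E = map_poly (\<lambda>c. [:c:]) q'" by blast
  have monic: "lead_coeff D = 1" "lead_coeff E = 1"
    using d(1) e(2) unfolding DE by (simp_all only: monic_map_poly_to_fract)
  \<comment> \<open>\<open>y\<close> does not occur in \<open>q\<close>, hence not in its factor \<open>d\<close>.\<close>
  have "degree (weight_poly 0 (map_poly (\<lambda>c. [:c:]) q')) \<le> 0"
    unfolding degree_weight_poly_le_iff
  proof (intro allI impI)
    fix i j assume "coeff (coeff (map_poly (\<lambda>c. [:c:]) q') j) i \<noteq> 0"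
    then show "i + 0 * j \<le> 0" by (cases i) (simp_all add: coeff_map_poly)
  qed
  then have "degree (weight_poly 0 D) \<le> 0"
    using degree_weight_poly_mult[of D E 0] monic_ne_0[OF monic(1)] monic_ne_0[OF monic(2)]
    by (simp add: DE(3))
  then have D0: "i = 0" if "coeff (coeff D k) i \<noteq> 0" for i k
    using that unfolding degree_weight_poly_le_iff by fastforce
  define d0 where "d0 = map_poly (\<lambda>p. coeff p 0) D"
  have "coeff D k = [:coeff (coeff D k) 0:]" for k
    using D0[of k] by (intro poly_eqI) (auto simp: coeff_pCons split: nat.splits)
  then have d0: "d = lift d0"
    by (intro poly_eqI) (metis DE(1) coeff_lift coeff_map_poly coeff_0 const_eq_to_fract d0_def to_fract_0)
  have "lift f = lift d0 * lift (f div d0) + lift (f mod d0)"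
    by (simp flip: unital_hom.hom_mult[OF unital_hom_lift] unital_hom.hom_add[OF unital_hom_lift])
  then have "difference_poly f = d * lift (f div d0) + (lift (f mod d0) - [:to_fract f:])"
    by (simp add: difference_poly_eq d0)
  then have "d dvd lift (f mod d0) - [:to_fract f:]"
    using d(3) by (metis dvd_add_right_iff dvd_triv_left)
  moreover have "degree (lift (f mod d0) - [:to_fract f:]) < degree d"
  proof -
    have "d0 \<noteq> 0" using pos by (auto simp: d0)
    then have "degree (f mod d0) < degree d0"
      using degree_mod_less[of d0 f] pos by (auto simp: d0)
    then show ?thesis
      by (intro degree_diff_less) (use pos in \<open>auto simp: d0\<close>)
  qed
  ultimately have "lift (f mod d0) - [:to_fract f:] = 0"
    by (metis dvd_imp_degree_le leD)
  then have "coeff (lift (f mod d0)) 0 = coeff [:to_fract f:] 0" by simp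
  then have "f = [:coeff (f mod d0) 0:]" by (simp add: const_eq_to_fract)
  then show False using f(2) by (metis degree_pCons_0 less_irrefl)
qed

definition eval_ac :: "'a::field poly fract alg_closure \<Rightarrow> 'a poly \<Rightarrow> 'a poly fract alg_closure" where
  "eval_ac \<beta> p = poly (map_poly (to_ac \<circ> const) p) \<beta>"

lemma unital_hom_to_ac_const: "unital_hom (to_ac \<circ> const)"
  by (intro unital_hom_comp unital_hom_const unital_hom_to_ac)

lemma unital_hom_eval_ac: "unital_hom (eval_ac \<beta>)"
  using unital_hom_comp[OF unital_hom_map_poly[OF unital_hom_to_ac_const] unital_hom_poly]
  by (simp add: eval_ac_def[abs_def] o_def)

lemma map_poly_to_ac_lift: "map_poly to_ac (lift p) = map_poly (to_ac \<circ> const) p"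
  unfolding lift_def by (rule map_poly_map_poly) (simp_all add: const_eq_to_fract)

lemma map_poly_to_ac_difference_poly:
  "map_poly to_ac (difference_poly f) = map_poly (to_ac \<circ> const) f - [:to_ac (to_fract f):]"
proof -
  interpret unital_hom "to_ac :: 'a poly fract \<Rightarrow> _" by (rule unital_hom_to_ac)
  show ?thesis
    by (simp add: difference_poly_eq map_poly_to_ac_lift)
qed

lemma eval_ac_pCons: "eval_ac \<beta> (pCons c p) = to_ac (const c) + \<beta> * eval_ac \<beta> p"
  by (simp add: eval_ac_def map_poly_pCons const_eq_to_fract)

lemma difference_poly_root_iff:
  "poly (map_poly to_ac (difference_poly f)) \<beta> = 0 \<longleftrightarrow> eval_ac \<beta> f = to_ac (to_fract f)"
  by (simp add: map_poly_to_ac_difference_poly eval_ac_def)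

definition transcendental :: "'a::field poly fract alg_closure \<Rightarrow> bool" where
  "transcendental \<beta> \<longleftrightarrow> (\<forall>q. eval_ac \<beta> q = 0 \<longrightarrow> q = 0)"

text \<open>If \<open>\<beta>\<close> were a root of \<open>q \<in> F[x]\<close>, then \<open>q(x)\<close> and \<open>f(x) - f(y)\<close> would have a nonconstant common
factor over \<open>F(y)\<close>.\<close>

lemma root_transcendental:
  fixes f :: "'a::field poly"
  assumes f: "lead_coeff f = 1" "degree f > 0"
    and \<beta>: "poly (map_poly to_ac (difference_poly f)) \<beta> = 0"
  shows "transcendental \<beta>"
  unfolding transcendental_def
proof (intro allI impI, rule ccontr)
  fix q assume q: "eval_ac \<beta> q = 0" and "q \<noteq> 0"
  interpret unital_hom "to_ac :: 'a poly fract \<Rightarrow> _" by (rule unital_hom_to_ac)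
  obtain d a b where d: "d dvd lift q" "d dvd difference_poly f" "d = a * lift q + b * difference_poly f"
    using field_poly_bezout by blast
  have root: "poly (map_poly to_ac d) \<beta> = 0"
    using q \<beta> by (simp add: d(3) eval_ac_def map_poly_to_ac_lift)
  define d' where "d' = smult (inverse (lead_coeff d)) d"
  have "d \<noteq> 0" using d(1) \<open>q \<noteq> 0\<close> lift_eq_iff[of q 0] by (auto simp: lift_def)
  then have "lead_coeff d' = 1" "d' dvd lift q" "d' dvd difference_poly f"
    using d(1,2) by (simp_all add: d'_def smult_dvd_iff)
  then have "degree d' = 0" by (rule constant_common_factor[OF f \<open>q \<noteq> 0\<close>])
  then have "degree d = 0" using \<open>d \<noteq> 0\<close> by (simp add: d'_def)
  then obtain c where "d = [:c:]" by (auto elim: degree_eq_zeroE)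
  then show False using root \<open>d \<noteq> 0\<close> by simp
qed

text \<open>The derivative of \<open>f(x) - f(y)\<close> is \<open>f'(x)\<close>, a nonzero polynomial over \<open>F\<close>, which has no
transcendental roots.\<close>

lemma simple_roots_difference_poly:
  fixes f :: "'a::field poly"
  assumes f: "lead_coeff f = 1" "pderiv f \<noteq> 0"
  shows "simple_roots (map_poly to_ac (difference_poly f))"
  unfolding simple_roots_def
proof (intro allI impI)
  fix \<beta> :: "'a poly fract alg_closure"
  assume \<beta>: "poly (map_poly to_ac (difference_poly f)) \<beta> = 0"
  have "degree f > 0" using f(2) by (metis degree_eq_zeroE gr0I pderiv_singleton)
  have "pderiv (map_poly to_ac (difference_poly f)) = map_poly (to_ac \<circ> const) (pderiv f)"
    by (simp add: map_poly_to_ac_difference_poly pderiv_diff pderiv_pCons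
        map_poly_pderiv[OF unital_hom_to_ac_const])
  then show "poly (pderiv (map_poly to_ac (difference_poly f))) \<beta> \<noteq> 0"
    using root_transcendental[OF f(1) \<open>degree f > 0\<close> \<beta>] f(2)
    by (auto simp: eval_ac_def transcendental_def)
qed

lemma subst_gen_Fract:
  assumes transcendental: "transcendental \<beta>" and "q \<noteq> 0"
  shows "subst_gen \<beta> (Fraction_Field.Fract p q) = eval_ac \<beta> p / eval_ac \<beta> q"
proof -
  interpret unital_hom "eval_ac \<beta>" by (rule unital_hom_eval_ac)
  have nz: "eval_ac \<beta> q \<noteq> 0" if "q \<noteq> 0" for q using transcendental that by (auto simp: transcendental_def)
  show ?thesis
    unfolding subst_gen_def eval_ac_def[symmetric]
  proof (rule the_equality)
    show "\<exists>p' q'. Fraction_Field.Fract p q = Fraction_Field.Fract p' q' \<and> eval_ac \<beta> q' \<noteq> 0 \<and>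
        eval_ac \<beta> p / eval_ac \<beta> q = eval_ac \<beta> p' / eval_ac \<beta> q'"
      using nz[OF \<open>q \<noteq> 0\<close>] by blast
  next
    fix v
    assume "\<exists>p' q'. Fraction_Field.Fract p q = Fraction_Field.Fract p' q' \<and> eval_ac \<beta> q' \<noteq> 0 \<and>
        v = eval_ac \<beta> p' / eval_ac \<beta> q'"
    then obtain p' q' where *: "Fraction_Field.Fract p q = Fraction_Field.Fract p' q'"
        "eval_ac \<beta> q' \<noteq> 0" "v = eval_ac \<beta> p' / eval_ac \<beta> q'" by blast
    have "q' \<noteq> 0" using *(2) by (auto simp: hom_zero)
    with *(1) \<open>q \<noteq> 0\<close> have "p * q' = p' * q" by (simp add: eq_fract)
    then have "eval_ac \<beta> p * eval_ac \<beta> q' = eval_ac \<beta> p' * eval_ac \<beta> q"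
      by (simp flip: hom_mult)
    then show "v = eval_ac \<beta> p / eval_ac \<beta> q"
      using *(2,3) nz[OF \<open>q \<noteq> 0\<close>] by (simp add: frac_eq_eq)
  qed
qed

lemma unital_hom_subst_gen:
  assumes transcendental: "transcendental \<beta>"
  shows "unital_hom (subst_gen \<beta>)"
proof -
  interpret e: unital_hom "eval_ac \<beta>" by (rule unital_hom_eval_ac)
  note Fract = subst_gen_Fract[OF transcendental]
  have nz: "eval_ac \<beta> q \<noteq> 0" if "q \<noteq> 0" for q using transcendental that by (auto simp: transcendental_def)
  show ?thesis
  proof
    fix x y :: "'a poly fract"
    obtain a b where x: "x = Fraction_Field.Fract a b" "b \<noteq> 0" by (cases x) auto
    obtain c d where y: "y = Fraction_Field.Fract c d" "d \<noteq> 0" by (cases y) auto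
    have bd: "b * d \<noteq> 0" using x(2) y(2) by simp
    show "subst_gen \<beta> (x + y) = subst_gen \<beta> x + subst_gen \<beta> y"
      using nz[OF x(2)] nz[OF y(2)]
      by (simp add: x y Fract[OF x(2)] Fract[OF y(2)] Fract[OF bd] e.hom_add e.hom_mult add_frac_eq)
    show "subst_gen \<beta> (x * y) = subst_gen \<beta> x * subst_gen \<beta> y"
      by (simp add: x y Fract[OF x(2)] Fract[OF y(2)] Fract[OF bd] e.hom_mult)
  next
    show "subst_gen \<beta> 1 = 1"
      unfolding One_fract_def by (subst Fract) (simp_all add: e.hom_one)
  qed
qed

lemma subst_gen_to_fract:
  assumes transcendental: "transcendental \<beta>"
  shows "subst_gen \<beta> (to_fract p) = eval_ac \<beta> p"
  unfolding to_fract_def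
  by (subst subst_gen_Fract[OF transcendental])
     (simp_all add: unital_hom.hom_one[OF unital_hom_eval_ac])

lemma map_subst_gen_lift:
  assumes transcendental: "transcendental \<beta>"
  shows "map_poly (subst_gen \<beta>) (lift p) = map_poly to_ac (lift p)"
proof -
  interpret s: unital_hom "subst_gen \<beta>" by (rule unital_hom_subst_gen[OF transcendental])
  interpret a: unital_hom "to_ac :: 'a poly fract \<Rightarrow> _" by (rule unital_hom_to_ac)
  show ?thesis
    by (intro poly_eqI)
       (simp add: const_eq_to_fract subst_gen_to_fract[OF transcendental] eval_ac_pCons
         unital_hom.hom_zero[OF unital_hom_eval_ac])
qed

section \<open>Decompositions and divisors of \<open>f(x) - f(y)\<close>\<close>

text \<open>The hypothesis \<open>inv\<close> makes each coefficient \<open>p(y)\<close> of \<open>P\<close> invariant under the substitution of a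
root of \<open>P\<close> for \<open>y\<close>. By the degree bound for factors, \<open>p(x) - p(y)\<close> has smaller degree than \<open>P\<close>
and therefore vanishes, except when \<open>p(y)\<close> is the constant coefficient. So \<open>P\<close> agrees with a
polynomial over \<open>F\<close> up to its constant coefficient, which is determined by the root \<open>y\<close>.\<close>

lemma difference_poly_if_coeffs_invariant:
  fixes f :: "'a::field poly"
  assumes f: "lead_coeff f = 1" "degree f > 0"
    and P: "P dvd difference_poly f" "lead_coeff P = 1" "poly P gen = 0"
    and inv: "\<And>p k. coeff P k = to_fract p \<Longrightarrow> P dvd difference_poly p"
  obtains h where "normal_poly h" "difference_poly h = P" "degree h = degree P"
proof -
  obtain P' where P': "P = map_poly to_fract P'"
    "\<And>k. k \<le> degree P \<Longrightarrow> degree (coeff P' k) \<le> degree P - k"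
    using monic_factor_of_difference_poly[OF f P(1,2)] by blast
  have coeff: "coeff P k = to_fract (coeff P' k)" for k
    by (simp add: P'(1) coeff_map_poly)
  have pos: "degree P > 0"
  proof (rule ccontr)
    assume "\<not> degree P > 0"
    then obtain c where "P = [:c:]" by (auto elim: degree_eq_zeroE)
    then show False using P(2,3) by simp
  qed
  have const: "degree (coeff P' k) = 0" if "k > 0" for k
  proof (rule ccontr)
    assume *: "degree (coeff P' k) \<noteq> 0"
    then have "k \<le> degree P"
      using coeff[of k] by (metis coeff_eq_0 degree_0 not_le to_fract_eq_0_iff)
    then have "degree (coeff P' k) < degree P"
      using P'(2)[of k] \<open>k > 0\<close> pos by linarith
    moreover have "degree P \<le> degree (coeff P' k)"
      using dvd_imp_degree_le[OF inv[OF coeff[of k]]] * by (simp add: difference_poly_eq_0_iff)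
    ultimately show False by simp
  qed
  define h where "h = map_poly (\<lambda>p. coeff p 0) P' - [:coeff (coeff P' 0) 0:]"
  have coeff_h: "coeff h k = (if k = 0 then 0 else coeff (coeff P' k) 0)" for k
    by (simp add: h_def coeff_map_poly coeff_pCons split: nat.splits)
  have lift_h: "lift h = P - [:coeff P 0:]"
  proof (intro poly_eqI)
    fix k
    have "coeff P' k = [:coeff (coeff P' k) 0:]" if "k > 0"
      using const[OF that] by (auto elim: degree_eq_zeroE)
    then show "coeff (lift h) k = coeff (P - [:coeff P 0:]) k"
      by (cases k) (simp_all add: coeff_h coeff const_eq_to_fract)
  qed
  have "poly (lift h) gen = - coeff P 0"
    by (simp add: lift_h P(3))
  then have "difference_poly h = P"
    by (simp add: difference_poly_def lift_h)
  moreover from this have deg: "degree h = degree P"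
    using degree_difference_poly[of h] by simp
  moreover have "normal_poly h"
  proof -
    have "const (lead_coeff h) = coeff (lift h) (degree P)" by (simp add: deg)
    also have "\<dots> = const 1"
      using pos P(2)
      by (simp add: lift_h coeff_pCons unital_hom.hom_one[OF unital_hom_const] split: nat.splits)
    finally show ?thesis by (simp add: normal_poly_def coeff_h)
  qed
  ultimately show ?thesis using that by blast
qed

lemma normal_poly_eqI:
  assumes "normal_poly h" "normal_poly h'" "difference_poly h = difference_poly h'"
  shows "h = h'"
proof (intro poly_eqI)
  fix k
  show "coeff h k = coeff h' k"
  proof (cases "k = 0")
    case True
    then show ?thesis using assms(1,2) by (simp add: normal_poly_def)
  next
    case False
    then show ?thesis
      using arg_cong[OF assms(3), of "\<lambda>p. coeff p k"] by (simp add: coeff_difference_poly)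
  qed
qed

lemma diff_dvd_pcompose_diff:
  fixes p q g :: "'r::comm_ring_1 poly"
  shows "p - q dvd pcompose g p - pcompose g q"
proof (induction g)
  case (pCons c g)
  have "pcompose (pCons c g) p - pcompose (pCons c g) q
      = (p - q) * pcompose g p + q * (pcompose g p - pcompose g q)"
    by (simp add: pcompose_pCons algebra_simps)
  then show ?case using pCons.IH by simp
qed simp

lemma pcompose_constant: "pcompose p [:c:] = [:poly p c:]"
  by (induction p) (simp_all add: pcompose_pCons mult.commute)

lemma difference_poly_dvd_pcompose: "difference_poly h dvd difference_poly (pcompose g h)"
proof -
  have "lift (pcompose g h) = pcompose (lift g) (lift h)"
    unfolding lift_def by (rule unital_hom.map_pcompose[OF unital_hom_const])
  moreover have "pcompose (lift g) [:to_fract h:] = [:to_fract (pcompose g h):]"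
    by (simp add: pcompose_constant poly_lift_to_fract)
  ultimately show ?thesis
    using diff_dvd_pcompose_diff[of "lift h" "[:to_fract h:]" "lift g"]
    by (simp add: difference_poly_eq)
qed

text \<open>This is the expansion of \<open>u\<close> in base \<open>h\<close>: replacing each power of \<open>h(x)\<close> in it by the same power of
\<open>h(y)\<close> does not change the class modulo \<open>h(x) - h(y)\<close>, and leaves a polynomial of degree less than
\<open>deg h\<close> in \<open>x\<close> whose coefficients are polynomials in \<open>h(y)\<close>.\<close>

lemma reduce_modulo_difference_poly:
  fixes h u :: "'a::field poly"
  assumes "degree h > 0"
  shows "\<exists>V. degree V < degree h \<and> difference_poly h dvd lift u - V \<and>
    (\<forall>k. \<exists>g. coeff V k = to_fract (pcompose g h))"
proof (induction "degree u" arbitrary: u rule: less_induct)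
  case less
  interpret l: unital_hom "lift :: 'a poly \<Rightarrow> _" by (rule unital_hom_lift)
  show ?case
  proof (cases "degree u < degree h")
    case True
    have "coeff (lift u) k = to_fract (pcompose [:coeff u k:] h)" for k
      by (simp add: const_eq_to_fract)
    then have "\<exists>g. coeff (lift u) k = to_fract (pcompose g h)" for k by blast
    then show ?thesis using True by (intro exI[of _ "lift u"]) simp
  next
    case False
    have "degree (u div h) < degree u"
      using assms False by (simp add: degree_div_less)
    from less[OF this] obtain V where V: "degree V < degree h"
        "difference_poly h dvd lift (u div h) - V"
        "\<And>k. \<exists>g. coeff V k = to_fract (pcompose g h)" by blast
    define W where "W = smult (to_fract h) V + lift (u mod h)"
    have "degree (u mod h) < degree h"
      using degree_mod_less[of h u] assms by (cases "h = 0") auto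
    then have "degree W < degree h"
      unfolding W_def using V(1) by (intro degree_add_less) auto
    moreover have "difference_poly h dvd lift u - W"
    proof -
      have "lift u = lift (u div h) * lift h + lift (u mod h)"
        by (simp flip: l.hom_mult l.hom_add)
      then have "lift u - W = lift (u div h) * difference_poly h
          + smult (to_fract h) (lift (u div h) - V)"
        by (simp add: W_def difference_poly_eq algebra_simps smult_diff_right)
      then show ?thesis using V(2) by (simp add: dvd_smult)
    qed
    moreover have "\<exists>g. coeff W k = to_fract (pcompose g h)" for k
    proof -
      obtain g where "coeff V k = to_fract (pcompose g h)" using V(3) by blast
      then have "coeff W k = to_fract (pcompose (pCons (coeff (u mod h) k) g) h)"
        by (simp add: W_def pcompose_pCons const_eq_to_fract add.commute)
      then show ?thesis by blast
    qed
    ultimately show ?thesis by blast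
  qed
qed

text \<open>The remainder of \<open>f(x)\<close> modulo \<open>h(x) - h(y)\<close> is \<open>f(y)\<close>; on the other hand its constant coefficient
is a polynomial in \<open>h(y)\<close>.\<close>

lemma pcompose_if_difference_poly_dvd:
  fixes f h :: "'a::field poly"
  assumes "degree h > 0" "difference_poly h dvd difference_poly f"
  obtains g where "f = pcompose g h"
proof -
  obtain V where V: "degree V < degree h" "difference_poly h dvd lift f - V"
      "\<And>k. \<exists>g. coeff V k = to_fract (pcompose g h)"
    using reduce_modulo_difference_poly[OF assms(1)] by blast
  have "V - [:to_fract f:] = difference_poly f - (lift f - V)"
    by (simp add: difference_poly_eq)
  then have "difference_poly h dvd V - [:to_fract f:]"
    using dvd_diff[OF assms(2) V(2)] by (simp only:)
  moreover have "degree (V - [:to_fract f:]) < degree (difference_poly h)"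
    using V(1) assms(1) by (simp add: degree_diff_less)
  ultimately have "V - [:to_fract f:] = 0"
    by (metis dvd_imp_degree_le leD)
  then have "coeff V 0 = to_fract f" by simp
  then show ?thesis using V(3)[of 0] that by auto
qed

lemma pcompose_right_cancel:
  fixes g :: "'a::field poly"
  assumes "pcompose g h = pcompose g' h" "degree h > 0"
  shows "g = g'"
proof -
  have "pcompose (g - g') h = 0" using assms(1) by (simp add: pcompose_diff)
  then show ?thesis using assms(2) by (simp add: pcompose_eq_0_iff)
qed

lemma find_unique_eq: "P x \<Longrightarrow> (\<And>y. P y \<Longrightarrow> y = x) \<Longrightarrow> find_unique P = Some x"
  unfolding find_unique_def by (metis the_equality)

lemma compute_pair_eq:
  fixes g :: "'a::field poly"
  assumes "P h" "\<And>h'. P h' \<Longrightarrow> h' = h" "f = pcompose g h" "degree h > 0"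
  shows "compute_pair f P = Some (g, h)"
proof -
  have "find_unique P = Some h" using assms(1,2) by (rule find_unique_eq)
  moreover have "find_unique (\<lambda>g. f = pcompose g h) = Some g"
    using assms(3,4) pcompose_right_cancel by (intro find_unique_eq) auto
  ultimately show ?thesis by (simp add: compute_pair_def)
qed

lemma decompositionI:
  fixes g :: "'a::field poly"
  assumes "f = pcompose g h" "2 \<le> degree h" "degree h < degree f"
  shows "decomposition f g h"
proof -
  have "degree f = degree g * degree h" by (simp add: assms(1) degree_pcompose)
  then have "degree g \<noteq> 0" "degree g \<noteq> 1" using assms(2,3) by auto
  then show ?thesis using assms by (simp add: decomposition_def)
qed

lemma decomposition_degree_less:
  fixes g :: "'a::field poly"
  assumes "decomposition f g h"
  shows "degree h < degree f"
proof -
  have "degree f = degree g * degree h" "2 \<le> degree g" "2 \<le> degree h"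
    using assms by (simp_all add: decomposition_def degree_pcompose)
  moreover from this have "2 * degree h \<le> degree g * degree h" by simp
  ultimately show ?thesis by linarith
qed

lemma normal_poly_lead_coeff: "normal_poly h \<Longrightarrow> lead_coeff h = 1"
  by (simp add: normal_poly_def)

lemma normal_poly_degree_pos: "normal_poly h \<Longrightarrow> degree h > 0"
  by (rule ccontr) (auto simp: normal_poly_def)

text \<open>Otherwise \<open>h'\<close> would be a right component of \<open>h\<close> of smaller degree. In both steps of the algorithm,
this identifies the polynomial that was found with the minimal one that was looked for.\<close>

lemma indecomposable_divisor_eq:
  assumes "normal_poly h" "indecomposable h" "normal_poly h'" "2 \<le> degree h'"
    and "difference_poly h' dvd difference_poly h"
  shows "h' = h"
proof -
  have "degree h' > 0" using assms(4) by simp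
  then obtain g where "h = pcompose g h'"
    using assms(5) pcompose_if_difference_poly_dvd by blast
  then have "\<not> degree h' < degree h"
    using decompositionI[of h g h'] assms(2,4) by (auto simp: decomposable_def)
  then have "degree (difference_poly h) \<le> degree (difference_poly h')" by simp
  then have "difference_poly h' = difference_poly h"
    using assms(1,3,5)
    by (intro monic_dvd_degree_eq monic_difference_poly normal_poly_lead_coeff normal_poly_degree_pos)
  then show ?thesis using assms(1,3) normal_poly_eqI by blast
qed

section \<open>Factorization into irreducibles\<close>

lemma monic_irreducible_factorization:
  fixes p :: "'k::field poly"
  assumes "lead_coeff p = 1"
  shows "\<exists>ps. prod_list ps = p \<and> (\<forall>q\<in>set ps. lead_coeff q = 1 \<and> irreducible q)"
  using assms
proof (induction "degree p" arbitrary: p rule: less_induct)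
  case less
  have "p \<noteq> 0" using less.prems by auto
  show ?case
  proof (cases "degree p = 0")
    case True
    then have "p = 1" using less.prems by (metis degree_eq_zeroE lead_coeff_pCons(2) one_pCons)
    then show ?thesis by (intro exI[of _ "[]"]) simp
  next
    case False
    then have "\<not> is_unit p" using \<open>p \<noteq> 0\<close> by (simp add: is_unit_iff_degree)
    show ?thesis
    proof (cases "irreducible p")
      case True
      then show ?thesis using less.prems by (intro exI[of _ "[p]"]) simp
    next
      case red: False
      then obtain a b where ab: "p = a * b" "\<not> is_unit a" "\<not> is_unit b"
        using \<open>p \<noteq> 0\<close> \<open>\<not> is_unit p\<close> unfolding irreducible_def by blast
      define a' where "a' = smult (inverse (lead_coeff a)) a"
      define b' where "b' = smult (lead_coeff a) b"
      have nz: "a \<noteq> 0" "b \<noteq> 0" using ab \<open>p \<noteq> 0\<close> by auto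
      then have lc: "lead_coeff a' = 1" by (simp add: a'_def)
      have p: "p = a' * b'" using nz by (simp add: ab(1) a'_def b'_def)
      have lc': "lead_coeff b' = 1"
        using less.prems lc by (simp add: p lead_coeff_mult)
      have "degree a > 0" "degree b > 0" using ab(2,3) nz by (simp_all add: is_unit_iff_degree)
      moreover have "degree p = degree a + degree b" using nz by (simp add: ab(1) degree_mult_eq)
      ultimately have "degree a' < degree p" "degree b' < degree p"
        using nz by (simp_all add: a'_def b'_def)
      with less.hyps lc lc' obtain ps qs where
        "prod_list ps = a'" "\<forall>q\<in>set ps. lead_coeff q = 1 \<and> irreducible q"
        "prod_list qs = b'" "\<forall>q\<in>set qs. lead_coeff q = 1 \<and> irreducible q"
        by meson
      then show ?thesis by (intro exI[of _ "ps @ qs"]) (auto simp: p)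
    qed
  qed
qed

lemma monic_linear_eq:
  fixes p :: "'k::field poly"
  assumes "degree p = 1" "lead_coeff p = 1"
  shows "p = [:- (- coeff p 0), 1:]"
  using assms by (intro poly_eqI) (auto simp: coeff_pCons coeff_eq_0 split: nat.splits)

lemma irreducible_root_degree:
  fixes p :: "'k::field poly"
  assumes "irreducible p" "poly p x = 0"
  shows "degree p = 1"
proof -
  obtain q where q: "p = [:- x, 1:] * q" using assms(2) by (auto simp: poly_eq_0_iff_dvd)
  have "\<not> is_unit [:- x, 1:]" by (simp add: is_unit_iff_degree)
  then have "is_unit q" using irreducibleD[OF assms(1) q] by blast
  moreover from this have "q \<noteq> 0" by auto
  ultimately have "q \<noteq> 0" "degree q = 0" by (simp_all add: is_unit_iff_degree)
  then show ?thesis by (simp add: q degree_mult_eq del: mult_pCons_left)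
qed

lemma irreducible_degree_pos:
  fixes p :: "'k::field poly"
  assumes "irreducible p"
  shows "degree p > 0"
proof -
  have "p \<noteq> 0" "\<not> is_unit p" using assms by (simp_all add: irreducible_def)
  then show ?thesis using is_unit_iff_degree by blast
qed

lemma factorization_exists:
  fixes f :: "'a::field poly"
  assumes "lead_coeff f = 1" "degree f > 0"
  shows "\<exists>r s \<psi> \<alpha>. factorization f r s \<psi> \<alpha>"
proof -
  obtain ps where ps: "prod_list ps = difference_poly f"
      "\<And>q. q \<in> set ps \<Longrightarrow> lead_coeff q = 1" "\<And>q. q \<in> set ps \<Longrightarrow> irreducible q"
    using monic_irreducible_factorization[OF monic_difference_poly[OF assms]] by blast
  have "poly (prod_list ps) gen = 0" by (simp add: ps(1) poly_difference_poly_gen)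
  then obtain q where q: "q \<in> set ps" "poly q gen = 0"
    by (induction ps) auto
  have "degree q = 1" using irreducible_root_degree ps(3) q by blast
  then have "q = [:coeff q 0, 1:]"
    using monic_linear_eq[OF _ ps(2)[OF q(1)]] by simp
  moreover from this have "coeff q 0 = - gen"
    using q(2) poly_pCons[of "coeff q 0" "[:1:]" gen] by (simp add: eq_neg_iff_add_eq_0)
  ultimately have q_eq: "q = [:- gen, 1:]" by simp
  obtain xs ys where split: "ps = xs @ q # ys" using q(1) by (auto dest: split_list)
  define qs where "qs = xs @ ys"
  have prod_ps: "prod_list ps = q * prod_list qs"
    by (simp add: split qs_def ac_simps)
  define ls where "ls = q # filter (\<lambda>p. degree p = 1) qs"
  define ns where "ns = filter (\<lambda>p. degree p \<noteq> 1) qs"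
  define us where "us = ls @ ns"
  have prod_filter: "prod_list (filter P xs) * prod_list (filter (\<lambda>x. \<not> P x) xs) = prod_list xs"
    for P and xs :: "'a poly fract poly list"
    by (induction xs) (simp_all add: ac_simps)
  have prod_us: "prod_list us = difference_poly f"
    using prod_filter[of "\<lambda>p. degree p = 1" qs]
    by (simp add: us_def ls_def ns_def mult.assoc flip: ps(1) prod_ps)
  have us: "lead_coeff p = 1" "irreducible p" if "p \<in> set us" for p
    using that ps(2,3) by (auto simp: us_def ls_def ns_def qs_def split)
  define \<psi> where "\<psi> i = us ! (i - 1)" for i
  define \<alpha> where "\<alpha> i = - coeff (\<psi> i) 0" for i
  have "factorization f (length us) (length ls) \<psi> \<alpha>"
    unfolding factorization_def
  proof (intro conjI ballI)
    have "(\<Prod>i=1..length us. \<psi> i) = (\<Prod>i<length us. us ! i)"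
      unfolding \<psi>_def by (rule prod.reindex_bij_witness[of _ Suc "\<lambda>i. i - 1"]) auto
    then show "difference_poly f = (\<Prod>i=1..length us. \<psi> i)"
      using prod_us by (simp add: prod.list_conv_set_nth atLeast0LessThan)
    show "1 \<le> length ls" "length ls \<le> length us" by (simp_all add: ls_def us_def)
    show "\<alpha> 1 = gen" by (simp add: \<alpha>_def \<psi>_def us_def ls_def q_eq)
  next
    fix i assume "i \<in> {1..length us}"
    then have "\<psi> i \<in> set us" by (auto simp: \<psi>_def intro!: nth_mem)
    then show "lead_coeff (\<psi> i) = 1" "irreducible (\<psi> i)" by (rule us)+
  next
    fix i assume i: "i \<in> {1..length ls}"
    then have "i - 1 < length ls" by auto
    then have "\<psi> i = ls ! (i - 1)" by (simp add: \<psi>_def us_def nth_append)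
    with i have *: "\<psi> i \<in> set ls" by (auto intro!: nth_mem)
    then have "\<psi> i \<in> set us" by (simp add: us_def)
    moreover have "degree (\<psi> i) = 1" using * \<open>degree q = 1\<close> by (auto simp: ls_def)
    ultimately show "\<psi> i = [:- \<alpha> i, 1:]"
      unfolding \<alpha>_def using monic_linear_eq us(1) by blast
  next
    fix i assume i: "i \<in> {length ls<..length us}"
    then have "\<psi> i = ns ! (i - 1 - length ls)" "i - 1 - length ls < length ns"
      by (auto simp: \<psi>_def us_def nth_append)
    then have *: "\<psi> i \<in> set ns" by simp
    then have "degree (\<psi> i) > 0" using us(2) irreducible_degree_pos by (auto simp: us_def)
    moreover have "degree (\<psi> i) \<noteq> 1" using * by (simp add: ns_def)
    ultimately show "2 \<le> degree (\<psi> i)" by linarith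
  qed
  then show ?thesis by blast
qed

section \<open>Linear factors and blocks\<close>

lemma those_map_Some: "(\<And>x. x \<in> set xs \<Longrightarrow> F x = Some (G x)) \<Longrightarrow> those (map F xs) = Some (map G xs)"
  by (induction xs) simp_all

lemma pcompose_fixed_imp_linear:
  fixes f :: "'a::field poly"
  assumes "pcompose f l = f" "degree f > 0"
  shows "degree l = 1"
  using degree_pcompose[of f l] assms by simp

lemma linear_pcompose_inverse:
  fixes l :: "'a::field poly"
  assumes "degree l = 1"
  obtains m where "pcompose l m = [:0, 1:]" "pcompose m l = [:0, 1:]"
proof -
  obtain b a where l: "l = [:b, a:]" using assms
    by (metis One_nat_def degree_eq_zeroE degree_pCons_eq_if nat.inject pCons_cases zero_neq_one)
  then have "a \<noteq> 0" using assms by auto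
  then show ?thesis
    by (intro that[of "[:- b / a, 1 / a:]"]) (simp_all add: l pcompose_pCons field_simps)
qed

lemma linear_form_to_fract: "degree l = 1 \<Longrightarrow> linear_form (to_fract l) = Some l"
  unfolding linear_form_def by (rule find_unique_eq) (auto simp: poly_lift_gen)

text \<open>For a regular action, left translations commute with right translations, which will be used as
\<open>\<rho>\<close> to move a block to the base point.\<close>

lemma block_translate:
  assumes B': "block G B B'" and bij: "bij_betw \<rho> B B"
    and commute: "\<And>\<sigma> x. \<sigma> \<in> G \<Longrightarrow> x \<in> B \<Longrightarrow> \<sigma> (\<rho> x) = \<rho> (\<sigma> x)"
    and closed: "\<And>\<sigma> x. \<sigma> \<in> G \<Longrightarrow> x \<in> B \<Longrightarrow> \<sigma> x \<in> B"
  shows "block G B (\<rho> ` B')"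
  unfolding block_def
proof (intro conjI ballI)
  have sub: "B' \<subseteq> B" using B' by (simp add: block_def)
  then show "\<rho> ` B' \<subseteq> B" using bij by (auto simp: bij_betw_def)
  fix \<sigma> assume \<sigma>: "\<sigma> \<in> G"
  have "\<sigma> ` \<rho> ` B' = \<rho> ` \<sigma> ` B'"
    using commute[OF \<sigma>] sub by (force simp: image_image)
  moreover have "\<rho> ` \<sigma> ` B' \<inter> \<rho> ` B' = \<rho> ` (\<sigma> ` B' \<inter> B')"
    using bij closed[OF \<sigma>] sub
    by (intro inj_on_image_Int[symmetric, of \<rho> B]) (auto simp: bij_betw_def)
  moreover have "\<sigma> ` B' \<inter> B' = {} \<or> \<sigma> ` B' \<inter> B' = B'"
    using B' \<sigma> by (simp add: block_def)
  ultimately show "\<sigma> ` \<rho> ` B' \<inter> \<rho> ` B' = {} \<or> \<sigma> ` \<rho> ` B' \<inter> \<rho> ` B' = \<rho> ` B'"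
    by auto
qed

text \<open>The data chosen by a run of the algorithm in its factorization step.\<close>

locale factored_difference =
  fixes f :: "'a::field poly" and r s :: nat
    and \<psi> :: "nat \<Rightarrow> 'a poly fract poly" and \<alpha> :: "nat \<Rightarrow> 'a poly fract"
  assumes monic_f: "lead_coeff f = 1"
    and pderiv_f: "pderiv f \<noteq> 0"
    and fact: "factorization f r s \<psi> \<alpha>"
begin

lemma degree_f: "degree f > 0"
  using pderiv_f by (metis degree_eq_zeroE gr0I pderiv_singleton)

lemma difference_poly_f: "difference_poly f = (\<Prod>i=1..r. \<psi> i)"
  using fact by (simp add: factorization_def)

lemma monic_psi: "i \<in> {1..r} \<Longrightarrow> lead_coeff (\<psi> i) = 1"
  and irreducible_psi: "i \<in> {1..r} \<Longrightarrow> irreducible (\<psi> i)"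
  using fact by (simp_all add: factorization_def)

lemma s_bounds: "1 \<le> s" "s \<le> r"
  using fact by (simp_all add: factorization_def)

lemma alpha_1: "\<alpha> 1 = gen"
  using fact by (simp add: factorization_def)

lemma psi_linear: "i \<in> {1..s} \<Longrightarrow> \<psi> i = [:- \<alpha> i, 1:]"
  using fact unfolding factorization_def by blast

lemma psi_nonlinear: "i \<in> {s<..r} \<Longrightarrow> 2 \<le> degree (\<psi> i)"
  using fact unfolding factorization_def by blast

lemma psi_dvd: "i \<in> {1..r} \<Longrightarrow> \<psi> i dvd difference_poly f"
  unfolding difference_poly_f by (rule dvd_prodI) simp_all

lemma simple_roots_divisor:
  assumes "P dvd difference_poly f"
  shows "simple_roots (map_poly to_ac P)"
  using simple_roots_dvd[OF simple_roots_difference_poly[OF monic_f pderiv_f]]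
    unital_hom.map_dvd[OF unital_hom_to_ac assms] by blast

lemma psi_common_root_imp_eq:
  assumes "i \<in> {1..r}" "j \<in> {1..r}"
    and "poly (map_poly to_ac (\<psi> i)) x = 0" "poly (map_poly to_ac (\<psi> j)) x = 0"
  shows "i = j"
proof (rule ccontr)
  assume "i \<noteq> j"
  interpret unital_hom "to_ac :: 'a poly fract \<Rightarrow> _" by (rule unital_hom_to_ac)
  have "difference_poly f = \<psi> i * (\<psi> j * (\<Prod>k\<in>{1..r} - {i} - {j}. \<psi> k))"
    using assms(1,2) \<open>i \<noteq> j\<close> unfolding difference_poly_f
    by (subst prod.remove[of _ i]; simp; subst prod.remove[of _ j]; simp)
  then obtain q where "difference_poly f = \<psi> i * (\<psi> j * q)" by blast
  then have "poly (map_poly to_ac (difference_poly f)) x = 0"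
    "poly (pderiv (map_poly to_ac (difference_poly f))) x = 0"
    using assms(3,4) by (simp_all add: pderiv_mult)
  then show False
    using simple_roots_difference_poly[OF monic_f pderiv_f] unfolding simple_roots_def by blast
qed

lemma inj_on_alpha: "inj_on \<alpha> {1..s}"
proof (rule inj_onI)
  fix i j assume ij: "i \<in> {1..s}" "j \<in> {1..s}" "\<alpha> i = \<alpha> j"
  interpret unital_hom "to_ac :: 'a poly fract \<Rightarrow> _" by (rule unital_hom_to_ac)
  show "i = j"
    using ij s_bounds
    by (intro psi_common_root_imp_eq[of i j "to_ac (\<alpha> i)"]) (simp_all add: psi_linear)
qed

definition B :: "'a poly fract set" where
  "B = \<alpha> ` {1..s}"

lemma finite_B: "finite B" and card_B: "card B = s"
  using card_image[OF inj_on_alpha] by (simp_all add: B_def)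

lemma gen_in_B: "gen \<in> B"
  unfolding B_def using alpha_1 s_bounds by force

text \<open>A root in the base field belongs to an irreducible factor of degree one, so the linear factors
listed in a factorization account for all of them.\<close>

lemma root_iff_in_B: "poly (difference_poly f) \<gamma> = 0 \<longleftrightarrow> \<gamma> \<in> B"
proof
  assume "poly (difference_poly f) \<gamma> = 0"
  then obtain i where i: "i \<in> {1..r}" "poly (\<psi> i) \<gamma> = 0"
    by (auto simp: difference_poly_f poly_prod)
  then have "degree (\<psi> i) = 1" using irreducible_root_degree irreducible_psi by blast
  then have "i \<in> {1..s}" using psi_nonlinear[of i] i(1) by (cases "i \<le> s") auto
  then show "\<gamma> \<in> B" using i(2) by (auto simp: psi_linear B_def)
next
  assume "\<gamma> \<in> B"
  then obtain i where i: "i \<in> {1..s}" "\<gamma> = \<alpha> i" by (auto simp: B_def)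
  then have "poly (\<psi> i) \<gamma> = 0" by (simp add: psi_linear)
  then show "poly (difference_poly f) \<gamma> = 0"
    using psi_dvd[of i] i(1) s_bounds by (auto elim!: dvdE)
qed

text \<open>Comparing degrees shows that these polynomials are linear; so they form a group under composition.\<close>

definition L :: "'a poly set" where
  "L = {l. pcompose f l = f}"

lemma L_pcompose: "l \<in> L \<Longrightarrow> m \<in> L \<Longrightarrow> pcompose l m \<in> L"
  by (simp add: L_def pcompose_assoc)

lemma L_degree: "l \<in> L \<Longrightarrow> degree l = 1"
  using pcompose_fixed_imp_linear degree_f by (auto simp: L_def)

lemma L_id: "[:0, 1:] \<in> L"
  by (simp add: L_def pcompose_idR)

lemma L_inverse:
  assumes "l \<in> L"
  obtains m where "m \<in> L" "pcompose l m = [:0, 1:]" "pcompose m l = [:0, 1:]"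
proof -
  obtain m where m: "pcompose l m = [:0, 1:]" "pcompose m l = [:0, 1:]"
    using linear_pcompose_inverse L_degree[OF assms] by blast
  have "pcompose f m = pcompose (pcompose f l) m" using assms by (simp add: L_def)
  also have "\<dots> = f" by (simp add: m pcompose_idR flip: pcompose_assoc)
  finally show ?thesis using that m by (simp add: L_def)
qed

lemma to_fract_in_B_iff: "to_fract l \<in> B \<longleftrightarrow> l \<in> L"
  by (simp add: L_def poly_difference_poly_to_fract flip: root_iff_in_B)

text \<open>By the degree bound for factors, a root \<open>\<gamma>\<close> in \<open>F(y)\<close> is a polynomial in \<open>y\<close>, being up to sign a
coefficient of the factor \<open>x - \<gamma>\<close>.\<close>

lemma B_eq: "B = to_fract ` L"
proof
  show "B \<subseteq> to_fract ` L"
  proof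
    fix \<gamma> assume \<gamma>: "\<gamma> \<in> B"
    then have "[:- \<gamma>, 1:] dvd difference_poly f"
      by (simp add: poly_eq_0_iff_dvd flip: root_iff_in_B)
    then obtain P' where "[:- \<gamma>, 1:] = map_poly to_fract P'"
      using monic_factor_of_difference_poly[OF monic_f degree_f, of "[:- \<gamma>, 1:]"] by auto
    then have "coeff [:- \<gamma>, 1:] 0 = coeff (map_poly to_fract P') 0" by simp
    then have "\<gamma> = to_fract (- coeff P' 0)"
      by (simp add: coeff_map_poly) (metis add.inverse_inverse)
    then show "\<gamma> \<in> to_fract ` L" using \<gamma> to_fract_in_B_iff by blast
  qed
  show "to_fract ` L \<subseteq> B" using to_fract_in_B_iff by blast
qed

abbreviation H :: "('a poly fract \<Rightarrow> 'a poly fract) set" where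
  "H \<equiv> act_on B ` L"

lemma act_on_to_fract: "m \<in> L \<Longrightarrow> act_on B l (to_fract m) = to_fract (pcompose l m)"
  by (simp add: act_on_def to_fract_in_B_iff poly_lift_to_fract)

lemma act_on_maps:
  assumes "l \<in> L" "x \<in> B"
  shows "act_on B l x \<in> B"
proof -
  obtain m where m: "x = to_fract m" "m \<in> L" using assms(2) B_eq by blast
  show ?thesis
    unfolding m(1) act_on_to_fract[OF m(2)] to_fract_in_B_iff by (rule L_pcompose[OF assms(1) m(2)])
qed

lemma act_on_compose:
  assumes "m \<in> L"
  shows "compose B (act_on B l) (act_on B m) = act_on B (pcompose l m)"
proof
  fix \<gamma>
  show "compose B (act_on B l) (act_on B m) \<gamma> = act_on B (pcompose l m) \<gamma>"
  proof (cases "\<gamma> \<in> B")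
    case True
    then obtain k where k: "\<gamma> = to_fract k" "k \<in> L" using B_eq by blast
    then show ?thesis
      using True assms by (simp add: compose_eq act_on_to_fract L_pcompose pcompose_assoc)
  qed (simp add: compose_def act_on_def)
qed

lemma act_on_id: "act_on B [:0, 1:] = (\<lambda>x\<in>B. x)"
proof
  fix \<gamma>
  show "act_on B [:0, 1:] \<gamma> = (\<lambda>x\<in>B. x) \<gamma>"
  proof (cases "\<gamma> \<in> B")
    case True
    then obtain k where "\<gamma> = to_fract k" "k \<in> L" using B_eq by blast
    then show ?thesis using True by (simp add: act_on_to_fract pcompose_pCons)
  qed (simp add: act_on_def)
qed

lemma act_on_in_Bij:
  assumes "l \<in> L"
  shows "act_on B l \<in> Bij B"
proof -
  obtain m where m: "m \<in> L" "pcompose l m = [:0, 1:]" "pcompose m l = [:0, 1:]"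
    using L_inverse[OF assms] by blast
  have maps: "act_on B k \<in> B \<rightarrow> B" if "k \<in> L" for k
    using act_on_maps[OF that] by blast
  have "bij_betw (act_on B l) B B"
  proof (rule bij_betwI[OF maps[OF assms] maps[OF m(1)]])
    fix x assume "x \<in> B"
    then show "act_on B m (act_on B l x) = x"
      using act_on_compose[OF assms, of m] m(3) act_on_id
      by (metis compose_eq restrict_apply')
  next
    fix x assume "x \<in> B"
    then show "act_on B l (act_on B m x) = x"
      using act_on_compose[OF m(1), of l] m(2) act_on_id
      by (metis compose_eq restrict_apply')
  qed
  then show ?thesis by (simp add: Bij_def act_on_def)
qed

lemma permutation_group_H: "permutation_group H B"
  unfolding permutation_group_def
proof (intro conjI group.subgroupI[OF group_BijGroup] finite_B)
  show "H \<subseteq> carrier (BijGroup B)"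
    using act_on_in_Bij by (auto simp: BijGroup_def)
  show "H \<noteq> {}" using L_id by blast
next
  fix x assume "x \<in> H"
  then obtain l where l: "l \<in> L" "x = act_on B l" by blast
  obtain m where m: "m \<in> L" "pcompose l m = [:0, 1:]" "pcompose m l = [:0, 1:]"
    using L_inverse[OF l(1)] by blast
  have "inv\<^bsub>BijGroup B\<^esub> x = act_on B m"
    using act_on_in_Bij[OF l(1)] act_on_in_Bij[OF m(1)]
    by (intro group.inv_equality[OF group_BijGroup])
       (simp_all add: l(2) BijGroup_def act_on_compose[OF l(1)] m(3) act_on_id)
  then show "inv\<^bsub>BijGroup B\<^esub> x \<in> H" using m(1) by blast
next
  fix x y assume "x \<in> H" "y \<in> H"
  then obtain l m where lm: "l \<in> L" "x = act_on B l" "m \<in> L" "y = act_on B m" by blast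
  have "x \<otimes>\<^bsub>BijGroup B\<^esub> y = act_on B (pcompose l m)"
    using act_on_in_Bij[OF lm(1)] act_on_in_Bij[OF lm(3)]
    by (simp add: lm BijGroup_def act_on_compose[OF lm(3)])
  then show "x \<otimes>\<^bsub>BijGroup B\<^esub> y \<in> H" using L_pcompose lm by blast
qed

text \<open>Under the identification of \<open>l(y)\<close> with \<open>l\<close>, the action on \<open>B\<close> is left multiplication, and the
translate of a block by one of its own elements meets the block at that element. So a block
through the identity is a subgroup.\<close>

lemma block_closed:
  assumes B': "block H B B'" "gen \<in> B'" and lm: "to_fract l \<in> B'" "to_fract m \<in> B'"
  shows "to_fract (pcompose l m) \<in> B'"
proof -
  have sub: "B' \<subseteq> B" using B'(1) by (simp add: block_def)
  have l: "l \<in> L" and m: "m \<in> L" using sub lm to_fract_in_B_iff by auto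
  have "act_on B l gen = to_fract l"
    using act_on_to_fract[OF L_id, of l] by (simp add: gen_eq_to_fract pcompose_idR)
  then have "to_fract l \<in> act_on B l ` B' \<inter> B'" using B'(2) lm(1) by (metis IntI image_eqI)
  then have "act_on B l ` B' \<inter> B' = B'"
    using B'(1) l unfolding block_def by blast
  moreover have "card (act_on B l ` B') = card B'"
    using act_on_in_Bij[OF l] sub
    by (intro card_image) (auto simp: Bij_def bij_betw_def inj_on_subset)
  moreover have "finite B'" using sub finite_B finite_subset by blast
  ultimately have "act_on B l ` B' = B'"
    by (metis card_subset_eq finite_imageI inf.cobounded1)
  then show ?thesis using lm(2) act_on_to_fract[OF m, of l] by (metis image_eqI)
qed

lemma prod_linear_dvd_difference_poly:
  "S \<subseteq> B \<Longrightarrow> (\<Prod>\<gamma>\<in>S. [:- \<gamma>, 1:]) dvd difference_poly f"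
  by (intro prod_linear_dvd) (auto simp: root_iff_in_B intro: finite_subset finite_B)

text \<open>Substituting \<open>l(y)\<close> for \<open>y\<close> multiplies the subgroup \<open>K\<close> that corresponds to the block by \<open>l\<close> on the
right, which permutes the linear factors of the product if \<open>l \<in> K\<close>. So the coefficients of the
product are invariant under these substitutions.\<close>

lemma block_to_normal_poly:
  assumes B': "block H B B'" "gen \<in> B'"
  obtains h where "normal_poly h" "difference_poly h = (\<Prod>\<gamma>\<in>B'. [:- \<gamma>, 1:])" "degree h = card B'"
proof -
  define P where "P = (\<Prod>\<gamma>\<in>B'. [:- \<gamma>, 1:])"
  have sub: "B' \<subseteq> B" using B'(1) by (simp add: block_def)
  have fin: "finite B'" using sub finite_B finite_subset by blast
  have dvd: "P dvd difference_poly f"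
    unfolding P_def by (rule prod_linear_dvd_difference_poly[OF sub])
  have monic: "lead_coeff P = 1" unfolding P_def by (rule monic_prod_linear)
  define K where "K = {l. to_fract l \<in> B'}"
  have B'_eq: "B' = to_fract ` K" using sub B_eq by (auto simp: K_def)
  have finK: "finite K" using fin unfolding B'_eq by (rule finite_imageD) (simp add: inj_on_def)
  define P' where "P' = (\<Prod>l\<in>K. [:- l, 1:])"
  have P: "P = map_poly to_fract P'"
    unfolding P_def P'_def B'_eq
    by (subst prod.reindex)
       (simp_all add: inj_on_def unital_hom.map_prod[OF unital_hom_to_fract]
          unital_hom.map_pCons[OF unital_hom_to_fract])
  have "P dvd difference_poly p" if p: "coeff P k = to_fract p" for p k
    unfolding P_def
  proof (rule prod_linear_dvd[OF fin])
    fix \<gamma> assume "\<gamma> \<in> B'"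
    then obtain l where l: "\<gamma> = to_fract l" "l \<in> K" by (auto simp: B'_eq)
    interpret c: unital_hom "\<lambda>p::'a poly. pcompose p l" by (rule unital_hom_pcompose)
    have p_eq: "p = coeff P' k" using p by (simp add: P coeff_map_poly)
    have linear: "degree l = 1" using l sub to_fract_in_B_iff L_degree by (auto simp: K_def)
    have inj: "inj_on (\<lambda>m. pcompose m l) K"
    proof (rule inj_onI)
      fix m m' assume "pcompose m l = pcompose m' l"
      then show "m = m'" using linear by (intro pcompose_right_cancel[of m l m']) simp_all
    qed
    moreover have "(\<lambda>m. pcompose m l) ` K \<subseteq> K"
      using block_closed[OF B'] l(2) by (auto simp: K_def)
    ultimately have surj: "(\<lambda>m. pcompose m l) ` K = K"
      using endo_inj_surj[OF finK] by blast
    have "map_poly (\<lambda>p. pcompose p l) P' = (\<Prod>m\<in>K. [:- pcompose m l, 1:])"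
      by (simp add: P'_def c.map_prod c.hom_uminus c.hom_one)
    also have "\<dots> = (\<Prod>m\<in>(\<lambda>m. pcompose m l) ` K. [:- m, 1:])"
      using inj by (simp add: prod.reindex)
    finally have "map_poly (\<lambda>p. pcompose p l) P' = P'"
      unfolding surj P'_def .
    then have "pcompose p l = p" unfolding p_eq by (metis c.coeff_map)
    then show "poly (difference_poly p) \<gamma> = 0"
      by (simp add: l(1) poly_difference_poly_to_fract)
  qed
  moreover have "poly P gen = 0"
    unfolding P_def using fin B'(2) by (simp add: poly_prod_linear_eq_0_iff)
  ultimately obtain h where "normal_poly h" "difference_poly h = P" "degree h = degree P"
    using difference_poly_if_coeffs_invariant[OF monic_f degree_f dvd monic] by blast
  then show ?thesis using that unfolding P_def by (simp add: degree_prod_linear)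
qed

lemma block_pair_eq:
  assumes h: "normal_poly h" "difference_poly h = (\<Prod>\<gamma>\<in>S. [:- \<gamma>, 1:])" and g: "f = pcompose g h"
  shows "block_pair f S = Some (g, h)"
proof -
  have "to_fract h = - (\<Prod>\<gamma>\<in>S. - \<gamma>)"
  proof -
    have "coeff (difference_poly h) 0 = (\<Prod>\<gamma>\<in>S. - \<gamma>)"
      by (simp add: h(2) poly_prod flip: poly_0_coeff_0)
    then have "- to_fract h = (\<Prod>\<gamma>\<in>S. - \<gamma>)"
      using h(1)
      by (simp add: coeff_difference_poly normal_poly_def unital_hom.hom_zero[OF unital_hom_const])
    then show ?thesis by (metis add.inverse_inverse)
  qed
  then have lift_h: "lift h = (\<Prod>\<gamma>\<in>S. [:- \<gamma>, 1:]) - [:\<Prod>\<gamma>\<in>S. - \<gamma>:]"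
    by (simp add: difference_poly_eq flip: h(2))
  show ?thesis
    unfolding block_pair_def
  proof (rule compute_pair_eq)
    show "lift h = (\<Prod>\<gamma>\<in>S. [:- \<gamma>, 1:]) - [:\<Prod>\<gamma>\<in>S. - \<gamma>:]" by (rule lift_h)
    show "h' = h" if "lift h' = (\<Prod>\<gamma>\<in>S. [:- \<gamma>, 1:]) - [:\<Prod>\<gamma>\<in>S. - \<gamma>:]" for h'
      using that unfolding lift_h[symmetric] lift_eq_iff .
  qed (fact g normal_poly_degree_pos[OF h(1)])+
qed

end

section \<open>Connected components of the graph\<close>

lemma gcd_ne_1_iff_common_root:
  fixes p q :: "'k::field alg_closure poly"
  assumes "p \<noteq> 0"
  shows "gcd p q \<noteq> 1 \<longleftrightarrow> (\<exists>x. poly p x = 0 \<and> poly q x = 0)"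
proof
  assume "gcd p q \<noteq> 1"
  then have "\<not> coprime p q" by (simp add: coprime_iff_gcd_eq_1)
  then obtain c where c: "c dvd p" "c dvd q" "\<not> is_unit c" by (auto elim: not_coprimeE)
  then have "c \<noteq> 0" using assms by auto
  with c(3) have "degree c > 0" by (simp add: is_unit_iff_degree)
  then obtain x where "poly c x = 0" using alg_closed_imp_poly_has_root by blast
  then have "poly p x = 0 \<and> poly q x = 0" using c(1,2) by (auto elim!: dvdE)
  then show "\<exists>x. poly p x = 0 \<and> poly q x = 0" ..
next
  assume "\<exists>x. poly p x = 0 \<and> poly q x = 0"
  then obtain x where "[:- x, 1:] dvd p" "[:- x, 1:] dvd q"
    by (auto simp: poly_eq_0_iff_dvd)
  then have "[:- x, 1:] dvd gcd p q" by (rule gcd_greatest)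
  moreover have "\<not> is_unit [:- x, 1:]" by (simp add: is_unit_iff_degree)
  ultimately show "gcd p q \<noteq> 1" by metis
qed

lemma map_subst_gen_difference_poly:
  assumes "transcendental \<beta>" "eval_ac \<beta> p = to_ac (to_fract p)"
  shows "map_poly (subst_gen \<beta>) (difference_poly p) = map_poly to_ac (difference_poly p)"
proof -
  interpret \<sigma>: unital_hom "subst_gen \<beta>" by (rule unital_hom_subst_gen[OF assms(1)])
  interpret a: unital_hom "to_ac :: 'a poly fract \<Rightarrow> _" by (rule unital_hom_to_ac)
  show ?thesis
    by (simp add: difference_poly_eq map_subst_gen_lift[OF assms(1)]
        subst_gen_to_fract[OF assms(1)] assms(2))
qed

context factored_difference
begin

context
  fixes \<beta> :: "'a poly fract alg_closure"
  assumes root: "poly (map_poly to_ac (difference_poly f)) \<beta> = 0"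
begin

lemma transcendental_beta: "transcendental \<beta>"
  by (rule root_transcendental[OF monic_f degree_f root])

interpretation \<sigma>: unital_hom "subst_gen \<beta>"
  by (rule unital_hom_subst_gen[OF transcendental_beta])

interpretation ac: unital_hom "to_ac :: 'a poly fract \<Rightarrow> _"
  by (rule unital_hom_to_ac)

lemma subst_difference_f:
  "map_poly (subst_gen \<beta>) (difference_poly f) = map_poly to_ac (difference_poly f)"
  using map_subst_gen_difference_poly[OF transcendental_beta] root difference_poly_root_iff by blast

lemma edge_iff:
  assumes "i \<in> {1..r}" "j \<in> {1..r}"
  shows "(Inl i, Inr j) \<in> graph_edges r \<psi> \<beta> \<longleftrightarrow>
    (\<exists>x. poly (map_poly to_ac (\<psi> i)) x = 0 \<and> poly (map_poly (subst_gen \<beta>) (\<psi> j)) x = 0)"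
proof -
  have "map_poly to_ac (\<psi> i) \<noteq> 0"
    by (rule monic_ne_0[OF ac.monic_map[OF monic_psi[OF assms(1)]]])
  then show ?thesis
    using assms gcd_ne_1_iff_common_root[of "map_poly to_ac (\<psi> i)" "map_poly (subst_gen \<beta>) (\<psi> j)"]
    by (auto simp: graph_edges_def)
qed

abbreviation connected :: "nat + nat \<Rightarrow> bool" where
  "connected v \<equiv> (v, Inl 1) \<in> (graph_edges r \<psi> \<beta> \<union> (graph_edges r \<psi> \<beta>)\<inverse>)\<^sup>*"

lemma graph_edgesD:
  assumes "(v, w) \<in> graph_edges r \<psi> \<beta>"
  obtains i j where "v = Inl i" "w = Inr j" "i \<in> {1..r}" "j \<in> {1..r}"
  using assms by (auto simp: graph_edges_def)

text \<open>A polynomial \<open>T\<close> with coefficients in \<open>F(y)\<close> that also has coefficients in \<open>F(\<beta>)\<close>, where it is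
obtained from \<open>T'\<close>. Along an edge, the two factors share a root, so divisibility of this
polynomial by one of them makes it vanish at a root of the other one, which is irreducible over
its own field.\<close>

lemma connected_dvd:
  assumes T: "map_poly to_ac T = map_poly (subst_gen \<beta>) T'" "\<psi> 1 dvd T"
    and "connected v"
  shows "case v of Inl i \<Rightarrow> \<psi> i dvd T | Inr j \<Rightarrow> \<psi> j dvd T'"
  using \<open>connected v\<close>
proof (induction rule: converse_rtrancl_induct)
  case base
  show ?case using T(2) by simp
next
  case (step v w)
  have root_T: "poly (map_poly to_ac T) x = 0 \<longleftrightarrow> poly (map_poly (subst_gen \<beta>) T') x = 0" for x
    by (simp add: T(1))
  from step.hyps(1) consider "(v, w) \<in> graph_edges r \<psi> \<beta>" | "(w, v) \<in> graph_edges r \<psi> \<beta>"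
    by blast
  then show ?case
  proof cases
    case 1
    then obtain i j where ij: "v = Inl i" "w = Inr j" "i \<in> {1..r}" "j \<in> {1..r}"
      by (rule graph_edgesD)
    then obtain x where x: "poly (map_poly to_ac (\<psi> i)) x = 0"
        "poly (map_poly (subst_gen \<beta>) (\<psi> j)) x = 0"
      using 1 edge_iff by auto
    have "map_poly (subst_gen \<beta>) (\<psi> j) dvd map_poly (subst_gen \<beta>) T'"
      using step.IH by (simp add: ij \<sigma>.map_dvd)
    then have "poly (map_poly to_ac T) x = 0"
      using x(2) by (auto simp: root_T elim!: dvdE)
    then show ?thesis
      using irreducible_dvd_if_common_root[OF unital_hom_to_ac irreducible_psi[OF ij(3)] x(1)]
      by (simp add: ij)
  next
    case 2
    then obtain i j where ij: "w = Inl i" "v = Inr j" "i \<in> {1..r}" "j \<in> {1..r}"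
      by (rule graph_edgesD)
    then obtain x where x: "poly (map_poly to_ac (\<psi> i)) x = 0"
        "poly (map_poly (subst_gen \<beta>) (\<psi> j)) x = 0"
      using 2 edge_iff by auto
    have "map_poly to_ac (\<psi> i) dvd map_poly to_ac T"
      using step.IH by (simp add: ij ac.map_dvd)
    then have "poly (map_poly (subst_gen \<beta>) T') x = 0"
      using x(1) by (auto simp flip: root_T elim!: dvdE)
    then show ?thesis
      using irreducible_dvd_if_common_root[OF \<sigma>.unital_hom_axioms irreducible_psi[OF ij(4)] x(2)]
      by (simp add: ij)
  qed
qed

abbreviation I where "I \<equiv> component r \<psi> \<beta>"

definition J :: "nat set" where
  "J = {j \<in> {1..r}. connected (Inr j)}"

definition P where "P = (\<Prod>i\<in>I. \<psi> i)"
text \<open>The product over the component on the other side of the graph.\<close>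

definition Q where "Q = (\<Prod>j\<in>J. \<psi> j)"

lemma I_iff: "i \<in> I \<longleftrightarrow> i \<in> {1..r} \<and> connected (Inl i)"
  by (simp add: component_def)

lemma I_subset: "I \<subseteq> {1..r}" and J_subset: "J \<subseteq> {1..r}"
  by (auto simp: component_def J_def)

lemma finite_I: "finite I" and finite_J: "finite J"
  using finite_subset[OF I_subset] finite_subset[OF J_subset] by simp_all

lemma one_in_I: "1 \<in> I"
  using s_bounds by (simp add: I_iff)

lemma P_dvd: "P dvd difference_poly f" and Q_dvd: "Q dvd difference_poly f"
  unfolding P_def Q_def difference_poly_f
  by (intro prod_dvd_prod_subset I_subset J_subset finite_atLeastAtMost)+

lemma monic_prod_psi: "A \<subseteq> {1..r} \<Longrightarrow> lead_coeff (\<Prod>i\<in>A. \<psi> i) = 1"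
  unfolding lead_coeff_prod by (intro prod.neutral) (auto simp: monic_psi)

lemma monic_P: "lead_coeff P = 1" and monic_Q: "lead_coeff Q = 1"
  unfolding P_def Q_def by (intro monic_prod_psi I_subset J_subset)+

lemma root_P_iff:
  "poly (map_poly to_ac P) x = 0 \<longleftrightarrow> (\<exists>i\<in>I. poly (map_poly to_ac (\<psi> i)) x = 0)"
  using finite_I by (simp add: P_def ac.map_prod poly_prod)

lemma root_Q_iff:
  "poly (map_poly (subst_gen \<beta>) Q) x = 0 \<longleftrightarrow>
    (\<exists>j\<in>J. poly (map_poly (subst_gen \<beta>) (\<psi> j)) x = 0)"
  using finite_J by (simp add: Q_def \<sigma>.map_prod poly_prod)

text \<open>Every root of \<open>P\<close> is a root of some \<open>\<psi>\<^sub>j\<^sup>*\<close>, since both families of factors have the same product; the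
shared root is an edge, so \<open>j\<close> belongs to the same component. Thus both sides have the same roots,
all of them simple.\<close>

lemma common_product: "map_poly to_ac P = map_poly (subst_gen \<beta>) Q"
proof (rule monic_dvd_antisym)
  let ?N = "map_poly to_ac (difference_poly f)"
  have N1: "?N = (\<Prod>i=1..r. map_poly to_ac (\<psi> i))"
    by (simp only: difference_poly_f ac.map_prod)
  have N2: "?N = (\<Prod>j=1..r. map_poly (subst_gen \<beta>) (\<psi> j))"
    unfolding subst_difference_f[symmetric] by (simp only: difference_poly_f \<sigma>.map_prod)
  have dvd_N: "map_poly to_ac P dvd ?N" "map_poly (subst_gen \<beta>) Q dvd ?N"
    using ac.map_dvd[OF P_dvd] \<sigma>.map_dvd[OF Q_dvd] by (simp_all add: subst_difference_f)
  have simple: "simple_roots ?N" by (rule simple_roots_difference_poly[OF monic_f pderiv_f])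
  have id: "map_poly (\<lambda>x. x) p = p" for p :: "'a poly fract alg_closure poly"
    by (rule map_poly_idI) simp
  have edge_closed: "connected (Inl i) \<longleftrightarrow> connected (Inr j)"
    if "i \<in> {1..r}" "j \<in> {1..r}" "poly (map_poly to_ac (\<psi> i)) x = 0"
      "poly (map_poly (subst_gen \<beta>) (\<psi> j)) x = 0" for i j x
  proof -
    have "(Inl i, Inr j) \<in> graph_edges r \<psi> \<beta>" using that edge_iff by blast
    then show ?thesis by (meson UnI1 UnI2 converseI converse_rtrancl_into_rtrancl)
  qed
  show "map_poly to_ac P dvd map_poly (subst_gen \<beta>) Q"
  proof (rule simple_roots_dvd_if_roots_subset[OF unital_hom_id]; unfold id)
    show "simple_roots (map_poly to_ac P)" using simple dvd_N(1) by (rule simple_roots_dvd)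
    fix x assume x: "poly (map_poly to_ac P) x = 0"
    then obtain i where i: "i \<in> I" "poly (map_poly to_ac (\<psi> i)) x = 0"
      unfolding root_P_iff by blast
    have "poly ?N x = 0" using x dvd_N(1) by (auto elim!: dvdE)
    then obtain j where j: "j \<in> {1..r}" "poly (map_poly (subst_gen \<beta>) (\<psi> j)) x = 0"
      by (auto simp: N2 poly_prod)
    then have "j \<in> J" using i edge_closed[of i j x] by (auto simp: I_iff J_def)
    then show "poly (map_poly (subst_gen \<beta>) Q) x = 0" using j(2) unfolding root_Q_iff by blast
  qed
  show "map_poly (subst_gen \<beta>) Q dvd map_poly to_ac P"
  proof (rule simple_roots_dvd_if_roots_subset[OF unital_hom_id]; unfold id)
    show "simple_roots (map_poly (subst_gen \<beta>) Q)" using simple dvd_N(2) by (rule simple_roots_dvd)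
    fix x assume x: "poly (map_poly (subst_gen \<beta>) Q) x = 0"
    then obtain j where j: "j \<in> J" "poly (map_poly (subst_gen \<beta>) (\<psi> j)) x = 0"
      unfolding root_Q_iff by blast
    have "poly ?N x = 0" using x dvd_N(2) by (auto elim!: dvdE)
    then obtain i where i: "i \<in> {1..r}" "poly (map_poly to_ac (\<psi> i)) x = 0"
      by (auto simp: N1 poly_prod)
    then have "i \<in> I" using j edge_closed[of i j x] by (auto simp: I_iff J_def)
    then show "poly (map_poly to_ac P) x = 0" using i(2) unfolding root_P_iff by blast
  qed
  show "lead_coeff (map_poly to_ac P) = 1" by (rule ac.monic_map[OF monic_P])
  show "lead_coeff (map_poly (subst_gen \<beta>) Q) = 1" by (rule \<sigma>.monic_map[OF monic_Q])
qed

lemma psi_1_dvd_iff: "\<psi> 1 dvd T \<longleftrightarrow> poly T gen = 0"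
  using psi_linear[of 1] s_bounds by (simp add: alpha_1 poly_eq_0_iff_dvd del: One_nat_def)

lemma P_dvd_if_common:
  assumes "map_poly to_ac T = map_poly (subst_gen \<beta>) T'" "poly T gen = 0"
  shows "P dvd T"
proof (rule simple_roots_dvd_if_roots_subset[OF unital_hom_to_ac simple_roots_divisor[OF P_dvd]])
  fix x assume "poly (map_poly to_ac P) x = 0"
  then obtain i where i: "i \<in> I" "poly (map_poly to_ac (\<psi> i)) x = 0"
    unfolding root_P_iff by blast
  have "\<psi> i dvd T"
    using connected_dvd[OF assms(1) _, of "Inl i"] assms(2) i(1) psi_1_dvd_iff I_iff by simp
  then show "poly (map_poly to_ac T) x = 0"
    using i(2) by (auto elim!: dvdE)
qed

text \<open>By the preceding lemmas, the coefficients of \<open>P\<close> lie in \<open>F(y)\<close> and in \<open>F(\<beta>)\<close>. Therefore so do those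
of \<open>p(x) - c\<close> for any \<open>p \<in> F[x]\<close> and any coefficient \<open>c\<close> of \<open>P\<close>, and if \<open>c = p(y)\<close>, then \<open>P\<close>
divides this polynomial.\<close>

lemma component_normal_poly:
  obtains h where "normal_poly h" "difference_poly h = P" "degree h = degree P"
proof (rule difference_poly_if_coeffs_invariant[OF monic_f degree_f P_dvd monic_P])
  have "poly (\<psi> 1) gen = 0" using psi_1_dvd_iff[of "\<psi> 1"] by simp
  then show "poly P gen = 0"
    unfolding P_def poly_prod using finite_I one_in_I by (auto simp: prod_zero_iff)
next
  fix p k assume p: "coeff P k = to_fract p"
  have "map_poly to_ac (difference_poly p) = map_poly (subst_gen \<beta>) (lift p - [:coeff Q k:])"
  proof -
    have "to_ac (to_fract p) = coeff (map_poly to_ac P) k" by (simp add: p)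
    also have "\<dots> = subst_gen \<beta> (coeff Q k)" by (simp add: common_product)
    finally show ?thesis
      by (simp add: difference_poly_eq map_subst_gen_lift[OF transcendental_beta])
  qed
  then show "P dvd difference_poly p"
    by (rule P_dvd_if_common) (rule poly_difference_poly_gen)
qed (use that in blast)

text \<open>If \<open>P\<close> is linear, then \<open>P = x - y\<close>, and \<open>Q\<close> is a linear factor of \<open>f(x) - f(\<beta>)\<close>, so \<open>y = l(\<beta>)\<close>
for a linear polynomial \<open>l\<close> over \<open>F\<close>. Then \<open>\<beta>\<close> lies in \<open>F(y)\<close> and cannot be the root of a
nonlinear irreducible factor.\<close>

lemma degree_P_ge_2:
  assumes \<nu>: "\<nu> \<in> {s<..r}" "poly (map_poly to_ac (\<psi> \<nu>)) \<beta> = 0"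
  shows "2 \<le> degree P"
proof (rule ccontr)
  assume less: "\<not> 2 \<le> degree P"
  obtain h where h: "normal_poly h" "difference_poly h = P" "degree h = degree P"
    by (rule component_normal_poly)
  with less have deg_P: "degree P = 1" using normal_poly_degree_pos[OF h(1)] by linarith
  have "degree P = degree Q"
    using arg_cong[OF common_product, of degree] ac.degree_map_monic[OF monic_P]
      \<sigma>.degree_map_monic[OF monic_Q] by simp
  then have Q: "Q = [:- (- coeff Q 0), 1:]"
    using deg_P monic_Q by (intro monic_linear_eq) simp_all
  have P: "P = [:coeff P 0, 1:]"
    using monic_linear_eq[OF deg_P monic_P] by simp
  have "poly P gen = 0" using h(2) poly_difference_poly_gen by metis
  then have P0: "gen = - coeff P 0"
    using poly_pCons[of "coeff P 0" "[:1:]" gen] P by (simp add: eq_neg_iff_add_eq_0 add.commute)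
  have "- coeff Q 0 \<in> B"
    using Q Q_dvd by (metis root_iff_in_B poly_eq_0_iff_dvd)
  then obtain l where l: "- coeff Q 0 = to_fract l" "l \<in> L" using B_eq by blast
  have "to_ac gen = - coeff (map_poly to_ac P) 0" by (simp add: P0)
  also have "\<dots> = subst_gen \<beta> (- coeff Q 0)" by (simp add: common_product \<sigma>.hom_uminus)
  also have "\<dots> = eval_ac \<beta> l" by (simp add: l(1) subst_gen_to_fract[OF transcendental_beta])
  finally have gen: "to_ac gen = eval_ac \<beta> l" .
  have "l = [:coeff l 0, coeff l 1:]" "coeff l 1 \<noteq> 0"
    using L_degree[OF l(2)]
    by (auto intro!: poly_eqI simp: coeff_pCons coeff_eq_0 split: nat.splits)
       (metis One_nat_def leading_coeff_0_iff degree_0 zero_neq_one)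
  then obtain b a where ba: "l = [:b, a:]" "a \<noteq> 0" by blast
  \<comment> \<open>Solving \<open>y = a \<beta> + b\<close> for \<open>\<beta>\<close>.\<close>
  define u where "u = (gen - const b) / const a"
  have "to_ac (const a) \<noteq> 0" using ba(2) by simp
  moreover have "to_ac gen = to_ac (const b) + \<beta> * to_ac (const a)"
    by (simp add: gen ba(1) eval_ac_pCons unital_hom.hom_zero[OF unital_hom_eval_ac])
  ultimately have "\<beta> = to_ac u" by (simp add: u_def field_simps)
  then have "poly (\<psi> \<nu>) u = 0" using \<nu>(2) by (simp add: ac.poly_map)
  then have "degree (\<psi> \<nu>) = 1"
    using \<nu>(1) by (intro irreducible_root_degree[OF irreducible_psi]) auto
  then show False using psi_nonlinear[OF \<nu>(1)] by simp
qed

lemma degree_P_less: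
  assumes "I \<noteq> {1..r}"
  shows "degree P < degree f"
proof -
  have pos: "degree (\<psi> i) > 0" if "i \<in> {1..r}" for i
    using irreducible_degree_pos[OF irreducible_psi[OF that]] .
  have ne: "\<psi> i \<noteq> 0" if "i \<in> {1..r}" for i using pos[OF that] by auto
  obtain i where i: "i \<in> {1..r} - I" using assms I_subset by blast
  have "degree P = (\<Sum>i\<in>I. degree (\<psi> i))"
    unfolding P_def using I_subset ne by (intro degree_prod_eq_sum_degree) blast
  also have "\<dots> < (\<Sum>i=1..r. degree (\<psi> i))"
    using I_subset i pos[of i] by (intro sum_strict_mono2) auto
  also have "\<dots> = degree (difference_poly f)"
    unfolding difference_poly_f using ne by (intro degree_prod_eq_sum_degree[symmetric]) blast
  finally show ?thesis by simp
qed

lemma graph_step_result: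
  assumes \<nu>: "\<nu> \<in> {s<..r}" "poly (map_poly to_ac (\<psi> \<nu>)) \<beta> = 0"
  obtains "I = {1..r}" "graph_step f r \<psi> \<beta> = Some []"
  | g h where "graph_step f r \<psi> \<beta> = Some [(g, h)]" "decomposition f g h"
      "normal_poly h" "difference_poly h = P"
proof (cases "I = {1..r}")
  case True
  then show ?thesis using that(1) by (simp add: graph_step_def)
next
  case False
  obtain h where h: "normal_poly h" "difference_poly h = P" "degree h = degree P"
    by (rule component_normal_poly)
  have "difference_poly h dvd difference_poly f" using P_dvd by (simp add: h(2))
  then obtain g where g: "f = pcompose g h"
    using pcompose_if_difference_poly_dvd normal_poly_degree_pos[OF h(1)] by blast
  have "compute_pair f (\<lambda>h. normal_poly h \<and> difference_poly h = (\<Prod>i\<in>I. \<psi> i)) = Some (g, h)"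
  proof (rule compute_pair_eq[where P = "\<lambda>h. normal_poly h \<and> difference_poly h = (\<Prod>i\<in>I. \<psi> i)"])
    show "normal_poly h \<and> difference_poly h = (\<Prod>i\<in>I. \<psi> i)" using h by (simp add: P_def)
    show "h' = h" if "normal_poly h' \<and> difference_poly h' = (\<Prod>i\<in>I. \<psi> i)" for h'
      using that h(1,2) unfolding P_def by (metis normal_poly_eqI)
  qed (fact g normal_poly_degree_pos[OF h(1)])+
  then have "graph_step f r \<psi> \<beta> = Some [(g, h)]"
    using False by (simp add: graph_step_def Let_def)
  moreover have "decomposition f g h"
    using degree_P_ge_2[OF \<nu>] degree_P_less[OF False] h(3) by (intro decompositionI[OF g]) simp_all
  ultimately show ?thesis using that(2) h by blast
qed

text \<open>As \<open>h(\<beta>) = h(y)\<close>, the polynomial \<open>h(x) - h(y)\<close> has coefficients in both fields and hence is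
divisible by \<open>P\<close>.\<close>

lemma graph_step_finds:
  assumes min: "minimal_decomposition f g h"
    and \<nu>: "\<nu> \<in> {s<..r}" "poly (map_poly to_ac (\<psi> \<nu>)) \<beta> = 0" "\<psi> \<nu> dvd difference_poly h"
  shows "graph_step f r \<psi> \<beta> = Some [(g, h)]"
proof -
  have h: "decomposition f g h" "normal_poly h" "indecomposable h"
    using min by (simp_all add: minimal_decomposition_def)
  have "poly (map_poly to_ac (difference_poly h)) \<beta> = 0"
    using ac.map_dvd[OF \<nu>(3)] \<nu>(2) by (auto elim!: dvdE)
  then have "map_poly (subst_gen \<beta>) (difference_poly h) = map_poly to_ac (difference_poly h)"
    using map_subst_gen_difference_poly[OF transcendental_beta] difference_poly_root_iff by blast
  from P_dvd_if_common[OF this[symmetric] poly_difference_poly_gen]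
  have P_dvd_h: "P dvd difference_poly h" .
  from \<nu>(1,2) show ?thesis
  proof (cases rule: graph_step_result)
    case 1
    then have "P = difference_poly f" by (simp add: P_def difference_poly_f)
    then have "degree f \<le> degree h"
      using dvd_imp_degree_le[OF P_dvd_h] normal_poly_degree_pos[OF h(2)]
      by (simp add: difference_poly_eq_0_iff)
    then show ?thesis using decomposition_degree_less[OF h(1)] by simp
  next
    case (2 g' h')
    have "h' = h"
      using indecomposable_divisor_eq[OF h(2,3) 2(3)] 2(2,4) P_dvd_h
      by (simp add: decomposition_def)
    moreover have "g' = g"
      using 2(2) h(1) normal_poly_degree_pos[OF h(2)] pcompose_right_cancel \<open>h' = h\<close>
      by (metis decomposition_def)
    ultimately show ?thesis using 2(1) by simp
  qed
qed

end

section \<open>The linear step\<close>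

definition coefficient_form :: "nat \<Rightarrow> 'a poly" where
  "coefficient_form i = (THE l. \<alpha> i = to_fract l)"

lemma alpha_eq_to_fract:
  assumes "i \<in> {1..s}"
  shows "\<alpha> i = to_fract (coefficient_form i)" and "coefficient_form i \<in> L"
proof -
  have "\<alpha> i \<in> B" using assms by (auto simp: B_def)
  then obtain l where l: "\<alpha> i = to_fract l" "l \<in> L" using B_eq by blast
  then have "coefficient_form i = l" by (simp add: coefficient_form_def)
  then show "\<alpha> i = to_fract (coefficient_form i)" "coefficient_form i \<in> L" using l by simp_all
qed

lemma linear_forms:
  "those (map (\<lambda>i. linear_form (\<alpha> i)) [1..<Suc s]) = Some (map coefficient_form [1..<Suc s])"
proof (rule those_map_Some)
  fix i assume "i \<in> set [1..<Suc s]"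
  then have i: "i \<in> {1..s}" by auto
  show "linear_form (\<alpha> i) = Some (coefficient_form i)"
    unfolding alpha_eq_to_fract(1)[OF i]
    by (rule linear_form_to_fract[OF L_degree[OF alpha_eq_to_fract(2)[OF i]]])
qed

lemma set_linear_forms: "set (map coefficient_form [1..<Suc s]) = L"
proof
  show "set (map coefficient_form [1..<Suc s]) \<subseteq> L"
    using alpha_eq_to_fract(2) by auto
  show "L \<subseteq> set (map coefficient_form [1..<Suc s])"
  proof
    fix l assume "l \<in> L"
    then have "to_fract l \<in> \<alpha> ` {1..s}" using to_fract_in_B_iff unfolding B_def by simp
    then obtain i where i: "i \<in> {1..s}" "\<alpha> i = to_fract l" by auto
    then have "coefficient_form i = l" using alpha_eq_to_fract(1) to_fract_eq_iff by metis
    then show "l \<in> set (map coefficient_form [1..<Suc s])"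
      using i(1) by (auto simp del: upt_Suc)
  qed
qed

text \<open>The linear step never gets stuck: the linear forms exist, and they induce a permutation group.\<close>

lemma linear_step_eq:
  "linear_step f s \<alpha> =
    (if s > 1 then {those (map (block_pair f) (filter (\<lambda>\<Lambda>. card \<Lambda> < degree f) \<Lambda>s)) | \<Lambda>s.
       \<Lambda>s \<in> Atkinson H B gen}
     else {Some []})"
  unfolding linear_step_def linear_forms option.case Let_def set_linear_forms
  by (simp only: B_def[symmetric] permutation_group_H if_True)

lemma block_subset: "block H B S \<Longrightarrow> S \<subseteq> B"
  by (simp add: block_def)

lemma card_ge_2_iff_nontrivial:
  assumes "S \<subseteq> B" "gen \<in> S"
  shows "2 \<le> card S \<longleftrightarrow> \<not> is_singleton S"
proof -
  have "finite S" using assms(1) finite_B finite_subset by blast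
  then have "card S \<noteq> 0" using assms(2) by auto
  then show ?thesis unfolding is_singleton_altdef by linarith
qed

lemma block_B: "block H B B"
  unfolding block_def
proof (intro conjI ballI disjI2)
  fix \<sigma> assume "\<sigma> \<in> H"
  then show "\<sigma> ` B \<inter> B = B" using act_on_in_Bij by (auto simp: Bij_def bij_betw_def)
qed simp

lemma Atkinson_block:
  assumes "s > 1" "\<Lambda>s \<in> Atkinson H B gen" "S \<in> set \<Lambda>s"
  shows "block H B S" "gen \<in> S" "2 \<le> card S"
proof -
  have *: "block H B S \<and> gen \<in> S \<and> 2 \<le> card S"
  proof (cases "primitive_group H B")
    case True
    then have "S = B" using assms(2,3) by (simp add: Atkinson_def)
    then show ?thesis using block_B gen_in_B assms(1) card_B by simp
  next
    case False
    then have "minimal_block H B gen S" using assms(2,3) by (simp add: Atkinson_def)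
    then show ?thesis
      using card_ge_2_iff_nontrivial[OF block_subset]
      by (auto simp: minimal_block_def trivial_block_def)
  qed
  then show "block H B S" "gen \<in> S" "2 \<le> card S" by simp_all
qed

lemma block_pair_of_block:
  assumes S: "block H B S" "gen \<in> S" "2 \<le> card S" "card S < degree f"
  obtains g h where "block_pair f S = Some (g, h)" "decomposition f g h"
proof -
  obtain h where h: "normal_poly h" "difference_poly h = (\<Prod>\<gamma>\<in>S. [:- \<gamma>, 1:])" "degree h = card S"
    using block_to_normal_poly[OF S(1,2)] by blast
  have "difference_poly h dvd difference_poly f"
    unfolding h(2) by (rule prod_linear_dvd_difference_poly[OF block_subset[OF S(1)]])
  then obtain g where g: "f = pcompose g h"
    using pcompose_if_difference_poly_dvd normal_poly_degree_pos[OF h(1)] by blast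
  show ?thesis
    using that block_pair_eq[OF h(1,2) g] decompositionI[OF g] S(3,4) h(3) by simp
qed

lemma linear_step_sound:
  assumes "out \<in> linear_step f s \<alpha>"
  obtains L where "out = Some L" "\<And>g h. (g, h) \<in> set L \<Longrightarrow> decomposition f g h"
proof (cases "s > 1")
  case False
  then show ?thesis using assms that[of "[]"] by (simp add: linear_step_eq)
next
  case True
  then obtain \<Lambda>s where \<Lambda>s: "\<Lambda>s \<in> Atkinson H B gen"
      "out = those (map (block_pair f) (filter (\<lambda>\<Lambda>. card \<Lambda> < degree f) \<Lambda>s))"
    using assms by (auto simp: linear_step_eq)
  have pair: "\<exists>gh. block_pair f S = Some gh \<and> decomposition f (fst gh) (snd gh)"
    if "S \<in> set (filter (\<lambda>\<Lambda>. card \<Lambda> < degree f) \<Lambda>s)" for S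
  proof -
    have S: "S \<in> set \<Lambda>s" "card S < degree f" using that by simp_all
    obtain g h where "block_pair f S = Some (g, h)" "decomposition f g h"
      by (rule block_pair_of_block[OF Atkinson_block[OF True \<Lambda>s(1) S(1)] S(2)])
    then show ?thesis by simp
  qed
  then have "out = Some (map (\<lambda>S. the (block_pair f S)) (filter (\<lambda>\<Lambda>. card \<Lambda> < degree f) \<Lambda>s))"
    unfolding \<Lambda>s(2) by (intro those_map_Some) (metis pair option.sel)
  moreover have "decomposition f g h"
    if mem: "(g, h) \<in> set (map (\<lambda>S. the (block_pair f S)) (filter (\<lambda>\<Lambda>. card \<Lambda> < degree f) \<Lambda>s))" for g h
  proof -
    obtain S where S: "S \<in> set (filter (\<lambda>\<Lambda>. card \<Lambda> < degree f) \<Lambda>s)" "(g, h) = the (block_pair f S)"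
      using mem unfolding set_map by (elim imageE) blast
    then show ?thesis using pair[OF S(1)] by (metis fst_conv option.sel snd_conv)
  qed
  ultimately show ?thesis using that by blast
qed

lemma linear_step_nonempty: "linear_step f s \<alpha> \<noteq> {}"
proof -
  have "{S. minimal_block H B gen S} \<subseteq> Pow B"
    by (auto simp: minimal_block_def block_def)
  then have "finite {S. minimal_block H B gen S}"
    using finite_B finite_subset by blast
  then have "\<exists>\<Lambda>s. \<Lambda>s \<in> Atkinson H B gen"
    unfolding Atkinson_def using finite_list[of "if primitive_group H B then {B} else {S. minimal_block H B gen S}"]
    by auto
  then show ?thesis by (auto simp: linear_step_eq)
qed

lemma difference_poly_eq_prod_roots:
  assumes dvd: "difference_poly h dvd difference_poly f" "normal_poly h"
    and linear: "\<And>\<nu>. \<nu> \<in> {s<..r} \<Longrightarrow> \<not> \<psi> \<nu> dvd difference_poly h"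
  defines "S \<equiv> {\<gamma> \<in> B. poly (difference_poly h) \<gamma> = 0}"
  shows "difference_poly h = (\<Prod>\<gamma>\<in>S. [:- \<gamma>, 1:])"
proof (rule monic_dvd_antisym)
  interpret ac: unital_hom "to_ac :: 'a poly fract \<Rightarrow> _" by (rule unital_hom_to_ac)
  have fin: "finite S" unfolding S_def using finite_B by simp
  show "(\<Prod>\<gamma>\<in>S. [:- \<gamma>, 1:]) dvd difference_poly h"
    by (rule prod_linear_dvd[OF fin]) (simp add: S_def)
  show "difference_poly h dvd (\<Prod>\<gamma>\<in>S. [:- \<gamma>, 1:])"
  proof (rule simple_roots_dvd_if_roots_subset[OF unital_hom_to_ac simple_roots_divisor[OF dvd(1)]])
    fix x assume x: "poly (map_poly to_ac (difference_poly h)) x = 0"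
    then have "poly (map_poly to_ac (difference_poly f)) x = 0"
      using ac.map_dvd[OF dvd(1)] by (auto elim!: dvdE)
    then obtain i where i: "i \<in> {1..r}" "poly (map_poly to_ac (\<psi> i)) x = 0"
      by (auto simp: difference_poly_f ac.map_prod poly_prod)
    then have i_dvd: "\<psi> i dvd difference_poly h"
      using irreducible_dvd_if_common_root[OF unital_hom_to_ac irreducible_psi _ x] by blast
    then have "i \<in> {1..s}" using linear[of i] i(1) by (cases "i \<le> s") auto
    then have \<psi>: "\<psi> i = [:- \<alpha> i, 1:]" "\<alpha> i \<in> B" by (auto simp: psi_linear B_def)
    then have "\<alpha> i \<in> S" using i_dvd by (simp add: S_def poly_eq_0_iff_dvd)
    moreover have "x = to_ac (\<alpha> i)" using i(2) by (simp add: \<psi>(1))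
    ultimately show "poly (map_poly to_ac (\<Prod>\<gamma>\<in>S. [:- \<gamma>, 1:])) x = 0"
      using fin by (auto simp: ac.poly_map poly_prod)
  qed
  show "lead_coeff (difference_poly h) = 1"
    using dvd(2) by (intro monic_difference_poly normal_poly_lead_coeff normal_poly_degree_pos)
  show "lead_coeff (\<Prod>\<gamma>\<in>S. [:- \<gamma>, 1:]) = 1" by (rule monic_prod_linear)
qed

text \<open>If \<open>h \<circ> m = h\<close> and \<open>h \<circ> l \<circ> m = h\<close>, then \<open>h \<circ> l = h\<close>; so an element of the group that maps one
root of \<open>h(x) - h(y)\<close> to another one preserves all roots.\<close>

lemma block_of_roots:
  assumes "degree h > 0"
  defines "S \<equiv> {\<gamma> \<in> B. poly (difference_poly h) \<gamma> = 0}"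
  shows "block H B S"
  unfolding block_def
proof (intro conjI ballI)
  have root: "to_fract k \<in> S \<longleftrightarrow> k \<in> L \<and> pcompose h k = h" for k
    by (simp add: S_def to_fract_in_B_iff poly_difference_poly_to_fract)
  show sub: "S \<subseteq> B" by (simp add: S_def)
  fix \<sigma> assume "\<sigma> \<in> H"
  then obtain l where l: "\<sigma> = act_on B l" "l \<in> L" by blast
  show "\<sigma> ` S \<inter> S = {} \<or> \<sigma> ` S \<inter> S = S"
  proof (cases "\<sigma> ` S \<inter> S = {}")
    case False
    then obtain x where x: "x \<in> S" "\<sigma> x \<in> S" by blast
    then obtain m where m: "to_fract m \<in> S" "\<sigma> (to_fract m) \<in> S"
      using B_eq sub by (metis imageE subsetD)
    have hm: "m \<in> L" "pcompose h m = h" using m(1) unfolding root by simp_all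
    have "pcompose h (pcompose l m) = h"
      using m(2) unfolding l(1) act_on_to_fract[OF hm(1)] root by simp
    with hm(2) have "pcompose (pcompose h l) m = pcompose h m"
      by (simp add: pcompose_assoc)
    then have hl: "pcompose h l = h"
      using pcompose_right_cancel[of "pcompose h l" m h] L_degree[OF hm(1)] by simp
    have "\<sigma> ` S \<subseteq> S"
    proof
      fix \<gamma> assume "\<gamma> \<in> \<sigma> ` S"
      then obtain k where k: "to_fract k \<in> S" "\<gamma> = \<sigma> (to_fract k)"
        using B_eq sub by (metis imageE subsetD)
      have hk: "k \<in> L" "pcompose h k = h" using k(1) unfolding root by simp_all
      show "\<gamma> \<in> S"
        unfolding k(2) l(1) act_on_to_fract[OF hk(1)] root
        using L_pcompose[OF l(2) hk(1)] hl hk(2) by (simp add: pcompose_assoc)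
    qed
    moreover have "inj_on \<sigma> S"
      using act_on_in_Bij[OF l(2)] sub by (auto simp: l(1) Bij_def bij_betw_def intro: inj_on_subset)
    ultimately have "\<sigma> ` S = S"
      using finite_subset[OF sub finite_B] by (intro endo_inj_surj)
    then show ?thesis by simp
  qed simp
qed

text \<open>Imprimitivity provides a nontrivial block somewhere; a right translation moves it to the
base point.\<close>

lemma imprimitive_block_at_gen:
  assumes "\<not> primitive_group H B"
  obtains S where "block H B S" "gen \<in> S" "2 \<le> card S" "S \<noteq> B"
proof -
  obtain S' where S': "block H B S'" "S' \<noteq> {}" "S' \<noteq> B" "\<not> is_singleton S'"
    using assms by (auto simp: primitive_group_def trivial_block_def)
  have sub: "S' \<subseteq> B" using S'(1) by (rule block_subset)
  obtain x where "x \<in> S'" using S'(2) by blast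
  with sub obtain l where l: "to_fract l \<in> S'" "l \<in> L" using B_eq by (metis imageE subsetD)
  obtain m where m: "m \<in> L" "pcompose l m = [:0, 1:]" "pcompose m l = [:0, 1:]"
    using L_inverse[OF l(2)] by blast
  \<comment> \<open>Right multiplication by the inverse of an element of the block moves this element to the
    identity.\<close>
  define \<rho> where "\<rho> \<gamma> = to_fract (pcompose (THE k. \<gamma> = to_fract k) m)" for \<gamma>
  have \<rho>: "\<rho> (to_fract k) = to_fract (pcompose k m)" for k by (simp add: \<rho>_def)
  have "inj_on \<rho> B"
  proof (rule inj_onI)
    fix x y assume "x \<in> B" "y \<in> B" "\<rho> x = \<rho> y"
    then obtain k k' where k: "x = to_fract k" "y = to_fract k'" "pcompose k m = pcompose k' m"
      using B_eq \<rho> by auto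
    have "degree m > 0" using L_degree[OF m(1)] by simp
    with k(3) have "k = k'" by (rule pcompose_right_cancel)
    then show "x = y" by (simp add: k)
  qed
  moreover have "\<rho> ` B \<subseteq> B" using L_pcompose[OF _ m(1)] by (auto simp: B_eq \<rho>)
  ultimately have bij: "bij_betw \<rho> B B"
    using endo_inj_surj[OF finite_B] by (auto simp: bij_betw_def)
  have "block H B (\<rho> ` S')"
  proof (rule block_translate[OF S'(1) bij])
    fix \<sigma> x assume \<sigma>: "\<sigma> \<in> H" and x: "x \<in> B"
    obtain k where k: "k \<in> L" "\<sigma> = act_on B k" using \<sigma> by blast
    obtain u where u: "u \<in> L" "x = to_fract u" using x B_eq by blast
    show "\<sigma> (\<rho> x) = \<rho> (\<sigma> x)"
      by (simp add: k u \<rho> act_on_to_fract L_pcompose m(1) pcompose_assoc)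
    show "\<sigma> x \<in> B" unfolding k(2) by (rule act_on_maps[OF k(1) x])
  qed
  moreover have "\<rho> (to_fract l) = gen" by (simp add: \<rho> m(2) gen_eq_to_fract)
  then have "gen \<in> \<rho> ` S'" using l(1) by (metis image_eqI)
  moreover have card: "card (\<rho> ` S') = card S'"
    using \<open>inj_on \<rho> B\<close> sub by (intro card_image) (rule inj_on_subset)
  moreover have "finite S'" using sub finite_B finite_subset by blast
  then have "card S' \<noteq> 0" "card S' < card B"
    using S'(2,3) sub finite_B by (auto intro: psubset_card_mono)
  moreover have "card S' \<noteq> 1" using S'(4) by (simp add: is_singleton_altdef)
  ultimately show ?thesis using that[of "\<rho> ` S'"] by fastforce
qed

text \<open>The set \<open>S\<close> of roots of \<open>h(x) - h(y)\<close> is a block, and each smaller block of at least two elements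
that contains the base point would give a proper right component of \<open>h\<close>. So \<open>S\<close> is a minimal
block, or all of \<open>B\<close> in the primitive case.\<close>

lemma linear_step_finds:
  assumes "out \<in> linear_step f s \<alpha>" "out = Some Ls"
    and min: "minimal_decomposition f g h"
    and linear: "\<And>\<nu>. \<nu> \<in> {s<..r} \<Longrightarrow> \<not> \<psi> \<nu> dvd difference_poly h"
  shows "(g, h) \<in> set Ls"
proof -
  have h: "decomposition f g h" "normal_poly h" "indecomposable h"
    using min by (simp_all add: minimal_decomposition_def)
  then have f_eq: "f = pcompose g h" by (simp add: decomposition_def)
  have dvd: "difference_poly h dvd difference_poly f"
    unfolding f_eq by (rule difference_poly_dvd_pcompose)
  define S where "S = {\<gamma> \<in> B. poly (difference_poly h) \<gamma> = 0}"
  have prod_S: "difference_poly h = (\<Prod>\<gamma>\<in>S. [:- \<gamma>, 1:])"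
    unfolding S_def using dvd h(2) linear by (rule difference_poly_eq_prod_roots)
  have block_S: "block H B S"
    unfolding S_def by (rule block_of_roots[OF normal_poly_degree_pos[OF h(2)]])
  have gen_S: "gen \<in> S" by (simp add: S_def gen_in_B poly_difference_poly_gen)
  have finite_S: "finite S" using block_subset[OF block_S] finite_B finite_subset by blast
  have "degree h = degree (\<Prod>\<gamma>\<in>S. [:- \<gamma>, 1:])" by (simp flip: prod_S)
  then have card_S: "card S = degree h" by (simp add: degree_prod_linear)
  have deg_h: "2 \<le> degree h" using h(1) by (simp add: decomposition_def)
  have "card S \<le> s" using card_mono[OF finite_B block_subset[OF block_S]] by (simp add: card_B)
  then have "s > 1" using card_S deg_h by simp
  then obtain \<Lambda>s where \<Lambda>s: "\<Lambda>s \<in> Atkinson H B gen"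
      "those (map (block_pair f) (filter (\<lambda>\<Lambda>. card \<Lambda> < degree f) \<Lambda>s)) = Some Ls"
    using assms(1,2) by (auto simp: linear_step_eq)
  have sub_block: "S' = S" if S': "block H B S'" "gen \<in> S'" "2 \<le> card S'" "S' \<subseteq> S" for S'
  proof -
    obtain h' where h': "normal_poly h'" "difference_poly h' = (\<Prod>\<gamma>\<in>S'. [:- \<gamma>, 1:])" "degree h' = card S'"
      using block_to_normal_poly[OF S'(1,2)] by blast
    have "difference_poly h' dvd difference_poly h"
      unfolding h'(2) prod_S using finite_S S'(4) by (rule prod_dvd_prod_subset)
    then have "h' = h"
      using indecomposable_divisor_eq[OF h(2,3) h'(1)] S'(3) h'(3) by simp
    then show ?thesis using S'(4) finite_S card_S h'(3) by (metis card_subset_eq)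
  qed
  have "S \<in> set \<Lambda>s"
  proof (cases "primitive_group H B")
    case True
    then have "S = B"
      using block_S gen_S card_S deg_h card_ge_2_iff_nontrivial[OF block_subset[OF block_S] gen_S]
      by (auto simp: primitive_group_def trivial_block_def)
    then show ?thesis using True \<Lambda>s(1) by (simp add: Atkinson_def)
  next
    case False
    have "S \<noteq> B"
      using imprimitive_block_at_gen[OF False] sub_block block_subset by metis
    moreover have "\<not> is_singleton S"
      using card_ge_2_iff_nontrivial[OF block_subset[OF block_S] gen_S] card_S deg_h by simp
    moreover have "trivial_block B S' \<or> S' = S"
      if "block H B S'" "gen \<in> S'" "S' \<subseteq> S" for S'
      using sub_block[OF that(1,2) _ that(3)] card_ge_2_iff_nontrivial[OF block_subset[OF that(1)] that(2)]
      by (auto simp: trivial_block_def)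
    ultimately have "minimal_block H B gen S"
      using block_S gen_S by (auto simp: minimal_block_def trivial_block_def)
    then show ?thesis using False \<Lambda>s(1) by (simp add: Atkinson_def)
  qed
  moreover have "card S < degree f" using card_S decomposition_degree_less[OF h(1)] by simp
  moreover have "block_pair f S = Some (g, h)" by (rule block_pair_eq[OF h(2) prod_S f_eq])
  moreover have "y \<in> set ys" if "those (map F xs) = Some ys" "x \<in> set xs" "F x = Some y"
    for F xs ys x and y :: "'a poly \<times> 'a poly"
    using that by (induction xs arbitrary: ys) (auto split: option.splits simp: map_option_case)
  ultimately show ?thesis using \<Lambda>s(2) by fastforce
qed

section \<open>Correctness of the algorithm\<close>

lemma all_graph_steps:
  assumes \<beta>: "\<And>\<nu>. \<nu> \<in> {s<..r} \<Longrightarrow> poly (map_poly to_ac (\<psi> \<nu>)) (\<beta> \<nu>) = 0"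
  obtains Ls where
    "those (map (\<lambda>\<nu>. graph_step f r \<psi> (\<beta> \<nu>)) [Suc s..<Suc r]) = Some Ls"
    "\<And>g h. (g, h) \<in> set (concat Ls) \<Longrightarrow> decomposition f g h"
    "\<And>g h \<nu>. minimal_decomposition f g h \<Longrightarrow> \<nu> \<in> {s<..r} \<Longrightarrow> \<psi> \<nu> dvd difference_poly h \<Longrightarrow>
       (g, h) \<in> set (concat Ls)"
proof -
  have root: "poly (map_poly to_ac (difference_poly f)) (\<beta> \<nu>) = 0" if "\<nu> \<in> {s<..r}" for \<nu>
    using unital_hom.map_dvd[OF unital_hom_to_ac psi_dvd[of \<nu>]] \<beta>[OF that] that
    by (auto elim!: dvdE)
  have step: "\<exists>L. graph_step f r \<psi> (\<beta> \<nu>) = Some L \<and> (\<forall>(g, h)\<in>set L. decomposition f g h)"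
    if \<nu>: "\<nu> \<in> {s<..r}" for \<nu>
    using graph_step_result[OF root[OF \<nu>] \<nu> \<beta>[OF \<nu>]] by (metis (no_types, lifting) case_prodI empty_iff empty_set list.simps(15) singletonD)
  define G where "G \<nu> = the (graph_step f r \<psi> (\<beta> \<nu>))" for \<nu>
  have G: "graph_step f r \<psi> (\<beta> \<nu>) = Some (G \<nu>)" if "\<nu> \<in> {s<..r}" for \<nu>
    using step[OF that] by (auto simp: G_def)
  show ?thesis
  proof (rule that)
    show "those (map (\<lambda>\<nu>. graph_step f r \<psi> (\<beta> \<nu>)) [Suc s..<Suc r]) = Some (map G [Suc s..<Suc r])"
      by (rule those_map_Some) (auto simp del: upt_Suc intro!: G)
    fix g h assume "(g, h) \<in> set (concat (map G [Suc s..<Suc r]))"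
    then obtain \<nu> where "\<nu> \<in> {s<..r}" "(g, h) \<in> set (G \<nu>)"
      by (auto simp del: upt_Suc simp: less_Suc_eq_le Suc_le_eq)
    then show "decomposition f g h" using step[of \<nu>] by (auto simp: G_def)
  next
    fix g h \<nu> assume *: "minimal_decomposition f g h" "\<nu> \<in> {s<..r}" "\<psi> \<nu> dvd difference_poly h"
    then have "graph_step f r \<psi> (\<beta> \<nu>) = Some [(g, h)]"
      using graph_step_finds[OF root[OF *(2)]] \<beta> by blast
    then have "(g, h) \<in> set (G \<nu>)" by (simp add: G_def)
    then show "(g, h) \<in> set (concat (map G [Suc s..<Suc r]))"
      using *(2) by (auto simp del: upt_Suc)
  qed
qed

lemma roots_exist:
  obtains \<beta> where "\<forall>\<nu>\<in>{s<..r}. poly (map_poly to_ac (\<psi> \<nu>)) (\<beta> \<nu>) = 0"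
proof -
  have "\<exists>x. poly (map_poly to_ac (\<psi> \<nu>)) x = 0" if "\<nu> \<in> {s<..r}" for \<nu>
  proof (rule alg_closed_imp_poly_has_root)
    have "degree (map_poly to_ac (\<psi> \<nu>)) = degree (\<psi> \<nu>)"
      using that by (intro unital_hom.degree_map_monic[OF unital_hom_to_ac monic_psi]) auto
    then show "0 < degree (map_poly to_ac (\<psi> \<nu>))" using psi_nonlinear[OF that] by simp
  qed
  then show ?thesis using that by metis
qed

end

theorem theorem3p22:
  fixes f :: "'a::field poly"
  assumes "lead_coeff f = 1"
    and "pderiv f \<noteq> 0"
  shows "minDec f \<noteq> {} \<and>
    (\<forall>out\<in>minDec f. \<exists>L. out = Some L \<and>
       (\<forall>(g, h)\<in>set L. decomposition f g h) \<and>
       (\<forall>g h. minimal_decomposition f g h \<longrightarrow> (g, h) \<in> set L) \<and>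
       (indecomposable f \<longrightarrow> L = []))"
proof (intro conjI ballI)
  have "degree f > 0" using assms(2) by (metis degree_eq_zeroE gr0I pderiv_singleton)
  then obtain r s \<psi> \<alpha> where fact: "factorization f r s \<psi> \<alpha>"
    using factorization_exists[OF assms(1)] by blast
  then interpret factored_difference f r s \<psi> \<alpha>
    using assms by unfold_locales
  obtain \<beta> where "\<forall>\<nu>\<in>{s<..r}. poly (map_poly to_ac (\<psi> \<nu>)) (\<beta> \<nu>) = 0"
    by (rule roots_exist)
  moreover obtain out where "out \<in> linear_step f s \<alpha>" using linear_step_nonempty by blast
  ultimately show "minDec f \<noteq> {}" unfolding minDec_def using fact by blast
next
  fix res assume "res \<in> minDec f"
  then obtain r s \<psi> \<alpha> \<beta> out where run: "factorization f r s \<psi> \<alpha>" "out \<in> linear_step f s \<alpha>"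
      "\<forall>\<nu>\<in>{s<..r}. poly (map_poly to_ac (\<psi> \<nu>)) (\<beta> \<nu>) = 0"
      "res = do {
        L \<leftarrow> out;
        Ls \<leftarrow> those (map (\<lambda>\<nu>. graph_step f r \<psi> (\<beta> \<nu>)) [Suc s..<Suc r]);
        Some (L @ concat Ls)
      }"
    unfolding minDec_def by blast
  interpret factored_difference f r s \<psi> \<alpha>
    using assms run(1) by unfold_locales
  obtain L where L: "out = Some L" "\<And>g h. (g, h) \<in> set L \<Longrightarrow> decomposition f g h"
    using linear_step_sound[OF run(2)] by blast
  obtain Ls where Ls:
      "those (map (\<lambda>\<nu>. graph_step f r \<psi> (\<beta> \<nu>)) [Suc s..<Suc r]) = Some Ls"
      "\<And>g h. (g, h) \<in> set (concat Ls) \<Longrightarrow> decomposition f g h"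
      "\<And>g h \<nu>. minimal_decomposition f g h \<Longrightarrow> \<nu> \<in> {s<..r} \<Longrightarrow> \<psi> \<nu> dvd difference_poly h \<Longrightarrow>
         (g, h) \<in> set (concat Ls)"
    using all_graph_steps[of \<beta>] run(3) by metis
  have sound: "\<forall>(g, h)\<in>set (L @ concat Ls). decomposition f g h"
    using L(2) Ls(2) unfolding set_append by blast
  have "(g, h) \<in> set (L @ concat Ls)" if "minimal_decomposition f g h" for g h
    using linear_step_finds[OF run(2) L(1) that] Ls(3)[OF that] by (metis Un_iff set_append)
  moreover have "L @ concat Ls = []" if "indecomposable f"
  proof (rule ccontr)
    assume "L @ concat Ls \<noteq> []"
    then obtain gh where "gh \<in> set (L @ concat Ls)" by (meson last_in_set)
    then show False using sound that unfolding decomposable_def by blast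
  qed
  moreover have "res = Some (L @ concat Ls)" unfolding run(4) L(1) Ls(1) by simp
  ultimately show "\<exists>L. res = Some L \<and>
       (\<forall>(g, h)\<in>set L. decomposition f g h) \<and>
       (\<forall>g h. minimal_decomposition f g h \<longrightarrow> (g, h) \<in> set L) \<and>
       (indecomposable f \<longrightarrow> L = [])"
    using sound by blast
qed

end
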